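(* Let $X$ be a (reduced, irreducible) smooth projective curve over an algebraically closed field $k$ of characteristic $p \ge 0$, and let $G_1, G_2 \subset \mathrm{Aut}(X)$ be finite subgroups of order at least three. (Inner case) Let $P_1, P_2$ be different points of $X$. A birational embedding $\varphi: X \to \mathbb{P}^2$ of degree $|G_1|+1$ such that $\varphi(P_1)$ and $\varphi(P_2)$ are different inner Galois points for $\varphi(X)$ and $G_{\varphi(P_i)}=G_i$ for $i=1,2$ is uniquely determined by the $4$-tuple $(G_1,G_2,P_1,P_2)$ up to projective equivalence; that is, if $\varphi$ and $\varphi'$ are two such birational embeddings, then there is a linear transformation $T$ of $\mathbb{P}^2$ with $\varphi' = T\circ\varphi$. (Outer case) Let $Q$ be a point of $X$. A birational embedding $\varphi: X \to \mathbb{P}^2$ of degree $|G_1|$ for which there exist two different outer Galois points $R_1, R_2 \in \mathbb{P}^2$ for $\varphi(X)$ with $G_{R_i}=G_i$ for $i=1,2$ and $\varphi(Q) \in \overline{R_1R_2}$ is uniquely determined by the $3$-tuple $(G_1,G_2,Q)$ up to projective equivalence; that is, if $\varphi$ and $\varphi'$ are two such birational embeddings (each with its own pair of outer Galois points), then there is a linear transformation $T$ of $\mathbb{P}^2$ with $\varphi' = T\circ\varphi$.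
   Context: A birational embedding $\varphi: X \to \mathbb{P}^2$ means a morphism that is birational onto its image; its degree is the degree of the plane curve $\varphi(X)$. A point $P \in \mathbb{P}^2$ is called a Galois point for $\varphi(X)$ if the extension of function fields $k(\varphi(X))/\pi_P^*k(\mathbb{P}^1)$ induced by the projection $\pi_P: \varphi(X) \dashrightarrow \mathbb{P}^1$ from $P$ is a Galois extension. A Galois point $P$ is inner if $P \in \varphi(X)\setminus \mathrm{Sing}(\varphi(X))$, and outer if $P \in \mathbb{P}^2\setminus \varphi(X)$. For a Galois point $P$, $G_P$ denotes the Galois group of this extension, regarded via $k(X)=k(\varphi(X))$ as a subgroup of $\mathrm{Aut}(X)$. $\overline{R_1R_2}$ denotes the line through $R_1$ and $R_2$. A linear transformation of $\mathbb{P}^2$ is an element of $\mathrm{PGL}(3,k)$. *)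

theory Defs
  imports
    "HOL-Library.Poly_Mapping"
    "HOL-Computational_Algebra.Polynomial"
    "HOL-Analysis.Cartesian_Space"
    "HOL-Algebra.Bij"
    "HOL-Algebra.QuotRing"
    "HOL-Algebra.Embedded_Algebras"
begin

section \<open>Polynomials in finitely many variables\<close>

type_synonym ('k, 'n) mpoly = "('n \<Rightarrow>\<^sub>0 nat) \<Rightarrow>\<^sub>0 'k"

definition mp_eval :: "('k::field, 'n::finite) mpoly \<Rightarrow> 'k ^ 'n \<Rightarrow> 'k" where
  "mp_eval F v =
     (\<Sum>m\<in>Poly_Mapping.keys F. Poly_Mapping.lookup F m * (\<Prod>i\<in>UNIV. v $ i ^ Poly_Mapping.lookup m i))"

definition mp_deriv :: "'n::finite \<Rightarrow> ('k::field, 'n) mpoly \<Rightarrow> ('k, 'n) mpoly" where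
  "mp_deriv i F =
     (\<Sum>m\<in>Poly_Mapping.keys F.
        Poly_Mapping.single (m - Poly_Mapping.single i 1)
          (of_nat (Poly_Mapping.lookup m i) * Poly_Mapping.lookup F m))"

definition gradient :: "('k::field, 'n::finite) mpoly \<Rightarrow> 'k ^ 'n \<Rightarrow> 'k ^ 'n" where
  "gradient F v = (\<chi> i. mp_eval (mp_deriv i F) v)"

definition homogeneous :: "nat \<Rightarrow> ('k::field, 'n::finite) mpoly \<Rightarrow> bool" where
  "homogeneous d F \<longleftrightarrow> (\<forall>m\<in>Poly_Mapping.keys F. (\<Sum>i\<in>UNIV. Poly_Mapping.lookup m i) = d)"

section \<open>Projective space and its Zariski topology\<close>

definition proportional :: "'k::field ^ 'n \<Rightarrow> 'k ^ 'n \<Rightarrow> bool" where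
  "proportional v w \<longleftrightarrow> v \<noteq> 0 \<and> w \<noteq> 0 \<and> (\<exists>c. c \<noteq> 0 \<and> w = c *s v)"

text \<open>The type \<open>('k, 'n) pspace\<close> is the projective space of dimension \<open>CARD('n) - 1\<close> over \<open>'k\<close>;
  its homogeneous coordinates are indexed by \<open>'n\<close>.  The function \<open>abs_pspace\<close> is meaningful on
  nonzero vectors only, and \<open>rep_pspace\<close> chooses some nonzero representative.\<close>

quotient_type (overloaded) ('k, 'n) pspace = "('k::field, 'n::finite) vec" / partial: proportional
proof (rule part_equivpI)
  have "(\<chi> i. (1 :: 'k)) \<noteq> (0 :: ('k, 'n) vec)"
    by (simp add: vec_eq_iff)
  then have "proportional (\<chi> i. (1 :: 'k)) ((\<chi> i. 1) :: ('k, 'n) vec)"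
    unfolding proportional_def by (intro conjI exI[of _ 1]) simp_all
  then show "\<exists>v :: ('k, 'n) vec. proportional v v" ..
  show "symp (proportional :: ('k, 'n) vec \<Rightarrow> _)"
  proof (rule sympI)
    fix v w :: "('k, 'n) vec"
    assume "proportional v w"
    then obtain c where "v \<noteq> 0" "w \<noteq> 0" "c \<noteq> 0" "w = c *s v"
      unfolding proportional_def by blast
    then show "proportional w v"
      unfolding proportional_def by (intro conjI exI[of _ "inverse c"]) (simp_all add: vector_smult_assoc)
  qed
  show "transp (proportional :: ('k, 'n) vec \<Rightarrow> _)"
  proof (rule transpI)
    fix u v w :: "('k, 'n) vec"
    assume "proportional u v" "proportional v w"
    then obtain c d where "u \<noteq> 0" "w \<noteq> 0" "c \<noteq> 0" "v = c *s u" "d \<noteq> 0" "w = d *s v"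
      unfolding proportional_def by blast
    then show "proportional u w"
      unfolding proportional_def by (intro conjI exI[of _ "d * c"]) (simp_all add: vector_smult_assoc)
  qed
qed

text \<open>Vanishing of a form at the chosen representative does not depend on the choice.\<close>

definition zero_locus :: "('k::field, 'n::finite) mpoly set \<Rightarrow> ('k, 'n) pspace set" where
  "zero_locus S = {P. \<forall>F\<in>S. mp_eval F (rep_pspace P) = 0}"

definition zariski_closed :: "('k::field, 'n::finite) pspace set \<Rightarrow> bool" where
  "zariski_closed Z \<longleftrightarrow> (\<exists>S. (\<forall>F\<in>S. \<exists>d. homogeneous d F) \<and> Z = zero_locus S)"

definition zariski_open :: "('k::field, 'n::finite) pspace set \<Rightarrow> bool" where
  "zariski_open U \<longleftrightarrow> zariski_closed (- U)"

definition irreducible_set :: "('k::field, 'n::finite) pspace set \<Rightarrow> bool" where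
  "irreducible_set X \<longleftrightarrow> X \<noteq> {} \<and>
     (\<forall>Z1 Z2. zariski_closed Z1 \<and> zariski_closed Z2 \<and> X \<subseteq> Z1 \<union> Z2 \<longrightarrow> X \<subseteq> Z1 \<or> X \<subseteq> Z2)"

section \<open>Smooth projective curves\<close>

definition has_closed_chain :: "('k::field, 'n::finite) pspace set \<Rightarrow> nat \<Rightarrow> bool" where
  "has_closed_chain X d \<longleftrightarrow>
     (\<exists>Z. (\<forall>i\<le>d. zariski_closed (Z i) \<and> irreducible_set (Z i) \<and> Z i \<subseteq> X) \<and>
          (\<forall>i<d. Z i \<subset> Z (Suc i)))"

definition has_dimension :: "('k::field, 'n::finite) pspace set \<Rightarrow> nat \<Rightarrow> bool" where
  "has_dimension X d \<longleftrightarrow> has_closed_chain X d \<and> \<not> has_closed_chain X (Suc d)"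

text \<open>The Jacobian criterion in homogeneous coordinates: the Jacobian matrix of the forms vanishing
  on \<open>X\<close> has rank \<open>(CARD('n) - 1) - dim X\<close> at \<open>P\<close>.\<close>

definition smooth_at :: "('k::field, 'n::finite) pspace set \<Rightarrow> ('k, 'n) pspace \<Rightarrow> bool" where
  "smooth_at X P \<longleftrightarrow>
     (\<exists>r. has_dimension X r \<and>
        vec.dim {gradient F (rep_pspace P) | F. (\<exists>d. homogeneous d F) \<and> X \<subseteq> zero_locus {F}}
          + r + 1 = CARD('n))"

definition sing :: "('k::field, 'n::finite) pspace set \<Rightarrow> ('k, 'n) pspace set" where
  "sing X = {P \<in> X. \<not> smooth_at X P}"

text \<open>A closed subset carries its reduced structure; this is used over algebraically closed fields
  only.\<close>

definition smooth_projective_curve :: "('k::field, 'n::finite) pspace set \<Rightarrow> bool" where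
  "smooth_projective_curve X \<longleftrightarrow>
     zariski_closed X \<and> irreducible_set X \<and> has_dimension X 1 \<and> sing X = {}"

section \<open>Morphisms and automorphisms\<close>

text \<open>Maps are total functions on the ambient projective space; only their values on the indicated
  subset are constrained.\<close>

definition morphism_on ::
  "('k::field, 'n::finite) pspace set \<Rightarrow> (('k, 'n) pspace \<Rightarrow> ('k, 'm::finite) pspace) \<Rightarrow> bool" where
  "morphism_on S \<phi> \<longleftrightarrow>
     (\<forall>P\<in>S. \<exists>U d (F :: 'm \<Rightarrow> ('k, 'n) mpoly).
        zariski_open U \<and> P \<in> U \<and> (\<forall>j. homogeneous d (F j)) \<and>
        (\<forall>Q\<in>U \<inter> S. (\<chi> j. mp_eval (F j) (rep_pspace Q)) \<noteq> 0 \<and>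
           \<phi> Q = abs_pspace (\<chi> j. mp_eval (F j) (rep_pspace Q))))"

definition aut_group ::
  "('k::field, 'n::finite) pspace set \<Rightarrow> (('k, 'n) pspace \<Rightarrow> ('k, 'n) pspace) monoid" where
  "aut_group X =
     (BijGroup X)\<lparr>carrier := {\<sigma> \<in> Bij X. morphism_on X \<sigma> \<and> morphism_on X (inv_into X \<sigma>)}\<rparr>"

text \<open>A birational embedding restricts to an isomorphism over some nonempty open subset \<open>V\<close> of its
  image.\<close>

definition birational_embedding ::
  "('k::field, 'n::finite) pspace set \<Rightarrow> (('k, 'n) pspace \<Rightarrow> ('k, 3) pspace) \<Rightarrow> bool" where
  "birational_embedding X \<phi> \<longleftrightarrow> morphism_on X \<phi> \<and>
     (\<exists>V \<psi>. zariski_open V \<and> V \<inter> \<phi> ` X \<noteq> {} \<and> morphism_on (V \<inter> \<phi> ` X) \<psi> \<and>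
        (\<forall>Q\<in>V \<inter> \<phi> ` X. \<psi> Q \<in> X \<and> \<phi> (\<psi> Q) = Q) \<and>
        (\<forall>P\<in>X. \<phi> P \<in> V \<longrightarrow> \<psi> (\<phi> P) = P))"

definition has_plane_degree :: "('k::field, 3) pspace set \<Rightarrow> nat \<Rightarrow> bool" where
  "has_plane_degree C d \<longleftrightarrow> (\<exists>F. irreducible F \<and> homogeneous d F \<and> C = zero_locus {F})"

section \<open>Function fields\<close>

definition regular_on ::
  "('k::field, 'n::finite) pspace set \<Rightarrow> (('k, 'n) pspace \<Rightarrow> 'k) \<Rightarrow> bool" where
  "regular_on S f \<longleftrightarrow>
     (\<forall>P\<in>S. \<exists>U d F G.
        zariski_open U \<and> P \<in> U \<and> homogeneous d F \<and> homogeneous d G \<and>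
        (\<forall>Q\<in>U \<inter> S. mp_eval G (rep_pspace Q) \<noteq> 0 \<and>
           f Q = mp_eval F (rep_pspace Q) / mp_eval G (rep_pspace Q)))"

text \<open>Rational functions on an irreducible set \<open>X\<close> are represented by the class of all functions
  agreeing with a given one on some nonempty open subset of \<open>X\<close>.  Since any two nonempty open
  subsets of \<open>X\<close> meet, each union over representatives below is a union of equal sets.\<close>

definition germ ::
  "('k::field, 'n::finite) pspace set \<Rightarrow> (('k, 'n) pspace \<Rightarrow> 'k) \<Rightarrow> (('k, 'n) pspace \<Rightarrow> 'k) set" where
  "germ X f = {g. \<exists>U. zariski_open U \<and> U \<inter> X \<noteq> {} \<and> (\<forall>Q\<in>U \<inter> X. g Q = f Q)}"

definition function_field ::
  "('k::field, 'n::finite) pspace set \<Rightarrow> (('k, 'n) pspace \<Rightarrow> 'k) set ring" where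
  "function_field X =
     \<lparr>carrier = {germ X f | f. \<exists>U. zariski_open U \<and> U \<inter> X \<noteq> {} \<and> regular_on (U \<inter> X) f},
      mult = \<lambda>a b. \<Union>f\<in>a. \<Union>g\<in>b. germ X (\<lambda>P. f P * g P),
      one = germ X (\<lambda>_. 1),
      zero = germ X (\<lambda>_. 0),
      add = \<lambda>a b. \<Union>f\<in>a. \<Union>g\<in>b. germ X (\<lambda>P. f P + g P)\<rparr>"

text \<open>Pullback of rational functions along a dominant rational map defined on \<open>X\<close>.\<close>

definition pullback ::
  "('k::field, 'n::finite) pspace set \<Rightarrow> (('k, 'n) pspace \<Rightarrow> ('k, 'm::finite) pspace) \<Rightarrow>
   (('k, 'm) pspace \<Rightarrow> 'k) set \<Rightarrow> (('k, 'n) pspace \<Rightarrow> 'k) set" where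
  "pullback X \<phi> a = (\<Union>f\<in>a. germ X (f \<circ> \<phi>))"

section \<open>Galois extensions\<close>

text \<open>In the following \<open>F\<close> is a subset of the carrier of the field \<open>K\<close>.  An extension is Galois
  if it is finite and \<open>F\<close> is the fixed field of the group of \<open>F\<close>-automorphisms of \<open>K\<close>.\<close>

definition galois_group :: "('a, 'b) ring_scheme \<Rightarrow> 'a set \<Rightarrow> ('a \<Rightarrow> 'a) set" where
  "galois_group K F =
     {\<tau> \<in> extensional (carrier K). \<tau> \<in> ring_iso K K \<and> (\<forall>a\<in>F. \<tau> a = a)}"

definition galois_extension :: "('a, 'b) ring_scheme \<Rightarrow> 'a set \<Rightarrow> bool" where
  "galois_extension K F \<longleftrightarrow>
     field K \<and> subfield F K \<and> ring.finite_dimension K F (carrier K) \<and>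
     {a \<in> carrier K. \<forall>\<tau>\<in>galois_group K F. \<tau> a = a} = F"

section \<open>Galois points of plane curves\<close>

text \<open>The projection from \<open>P\<close> is induced by a linear map onto a plane with kernel the line \<open>P\<close>.
  Its value at \<open>P\<close> is irrelevant.  Two choices of the matrix differ by an automorphism of the
  projective line, hence \<open>projected_field\<close> does not depend on the choice.\<close>

definition projection_matrix :: "('k::field, 3) pspace \<Rightarrow> 'k ^ 3 ^ 2" where
  "projection_matrix P = (SOME A. {v. A *v v = 0} = vec.span {rep_pspace P})"

definition projection :: "('k::field, 3) pspace \<Rightarrow> ('k, 3) pspace \<Rightarrow> ('k, 2) pspace" where
  "projection P Q = abs_pspace (projection_matrix P *v rep_pspace Q)"

definition projected_field ::
  "('k::field, 3) pspace set \<Rightarrow> ('k, 3) pspace \<Rightarrow> (('k, 3) pspace \<Rightarrow> 'k) set set" where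
  "projected_field C P = pullback C (projection P) ` carrier (function_field UNIV)"

definition galois_point :: "('k::field, 3) pspace set \<Rightarrow> ('k, 3) pspace \<Rightarrow> bool" where
  "galois_point C P \<longleftrightarrow> galois_extension (function_field C) (projected_field C P)"

definition inner_galois_point :: "('k::field, 3) pspace set \<Rightarrow> ('k, 3) pspace \<Rightarrow> bool" where
  "inner_galois_point C P \<longleftrightarrow> galois_point C P \<and> P \<in> C - sing C"

definition outer_galois_point :: "('k::field, 3) pspace set \<Rightarrow> ('k, 3) pspace \<Rightarrow> bool" where
  "outer_galois_point C P \<longleftrightarrow> galois_point C P \<and> P \<notin> C"

text \<open>For a birational embedding \<open>\<phi>\<close> of \<open>X\<close> with image \<open>C\<close>, pullback along \<open>\<phi>\<close> identifies the
  function fields of \<open>C\<close> and \<open>X\<close>.  An automorphism of \<open>X\<close> acts on the latter by pullback, hence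
  on the former.  This action is contravariant; composing it with inversion would give a
  homomorphism with the same image on every subgroup.\<close>

definition function_field_action ::
  "('k::field, 'n::finite) pspace set \<Rightarrow> (('k, 'n) pspace \<Rightarrow> ('k, 3) pspace) \<Rightarrow>
   (('k, 'n) pspace \<Rightarrow> ('k, 'n) pspace) \<Rightarrow>
   (('k, 3) pspace \<Rightarrow> 'k) set \<Rightarrow> (('k, 3) pspace \<Rightarrow> 'k) set" where
  "function_field_action X \<phi> \<sigma> =
     (\<lambda>a\<in>carrier (function_field (\<phi> ` X)).
        inv_into (carrier (function_field (\<phi> ` X))) (pullback X \<phi>)
          (pullback X \<sigma> (pullback X \<phi> a)))"

text \<open>The subgroup \<open>G\<close> of the automorphism group of \<open>X\<close> is the Galois group at \<open>P\<close> under this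
  identification.\<close>

definition is_galois_group_at ::
  "('k::field, 'n::finite) pspace set \<Rightarrow> (('k, 'n) pspace \<Rightarrow> ('k, 3) pspace) \<Rightarrow> ('k, 3) pspace \<Rightarrow>
   (('k, 'n) pspace \<Rightarrow> ('k, 'n) pspace) set \<Rightarrow> bool" where
  "is_galois_group_at X \<phi> P G \<longleftrightarrow>
     function_field_action X \<phi> ` G =
       galois_group (function_field (\<phi> ` X)) (projected_field (\<phi> ` X) P)"

section \<open>Lines and linear transformations of the plane\<close>

definition line_through :: "('k::field, 3) pspace \<Rightarrow> ('k, 3) pspace \<Rightarrow> ('k, 3) pspace set" where
  "line_through R1 R2 = {Q. rep_pspace Q \<in> vec.span {rep_pspace R1, rep_pspace R2}}"

definition plane_linear_transformation :: "(('k::field, 3) pspace \<Rightarrow> ('k, 3) pspace) \<Rightarrow> bool" where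
  "plane_linear_transformation T \<longleftrightarrow>
     (\<exists>M :: 'k ^ 3 ^ 3. invertible M \<and> (\<forall>Q. T Q = abs_pspace (M *v rep_pspace Q)))"

section \<open>Embeddings with two Galois points\<close>

definition inner_embedding ::
  "('k::field, 'n::finite) pspace set \<Rightarrow> (('k, 'n) pspace \<Rightarrow> ('k, 'n) pspace) set \<Rightarrow>
   (('k, 'n) pspace \<Rightarrow> ('k, 'n) pspace) set \<Rightarrow> ('k, 'n) pspace \<Rightarrow> ('k, 'n) pspace \<Rightarrow>
   (('k, 'n) pspace \<Rightarrow> ('k, 3) pspace) \<Rightarrow> bool" where
  "inner_embedding X G1 G2 P1 P2 \<phi> \<longleftrightarrow>
     birational_embedding X \<phi> \<and> has_plane_degree (\<phi> ` X) (card G1 + 1) \<and>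
     \<phi> P1 \<noteq> \<phi> P2 \<and>
     inner_galois_point (\<phi> ` X) (\<phi> P1) \<and> inner_galois_point (\<phi> ` X) (\<phi> P2) \<and>
     is_galois_group_at X \<phi> (\<phi> P1) G1 \<and> is_galois_group_at X \<phi> (\<phi> P2) G2"

definition outer_embedding ::
  "('k::field, 'n::finite) pspace set \<Rightarrow> (('k, 'n) pspace \<Rightarrow> ('k, 'n) pspace) set \<Rightarrow>
   (('k, 'n) pspace \<Rightarrow> ('k, 'n) pspace) set \<Rightarrow> ('k, 'n) pspace \<Rightarrow>
   (('k, 'n) pspace \<Rightarrow> ('k, 3) pspace) \<Rightarrow> bool" where
  "outer_embedding X G1 G2 Q \<phi> \<longleftrightarrow>
     birational_embedding X \<phi> \<and> has_plane_degree (\<phi> ` X) (card G1) \<and>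
     (\<exists>R1 R2. R1 \<noteq> R2 \<and>
        outer_galois_point (\<phi> ` X) R1 \<and> outer_galois_point (\<phi> ` X) R2 \<and>
        is_galois_group_at X \<phi> R1 G1 \<and> is_galois_group_at X \<phi> R2 G2 \<and>
        \<phi> Q \<in> line_through R1 R2)"

end

theory Submission
  imports Defs
begin

text \<open>Let \<open>L\<close> be the line through the two Galois points \<open>R\<^sub>1\<close>, \<open>R\<^sub>2\<close>, and choose coordinates with
  \<open>R\<^sub>1 = (1:0:0)\<close> and \<open>R\<^sub>2 = (0:1:0)\<close>, so that \<open>L\<close> is \<open>z = 0\<close>.  The function \<open>y/z\<close> on \<open>X\<close> generates
  the fixed field of \<open>G\<^sub>1\<close>, and \<open>x/z\<close> that of \<open>G\<^sub>2\<close>.  These fields do not depend on the embedding, so two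
  embeddings give functions \<open>y/z\<close>, \<open>y'/z'\<close> which are rational in each other and therefore
  differ by a Moebius transformation.  A point of \<open>X\<close> that both embeddings map to the line through
  their Galois points, but not to \<open>R\<^sub>1\<close>, is a pole of both functions, hence the transformation is
  affine; likewise for \<open>x/z\<close>.  In the inner case these poles are \<open>P\<^sub>2\<close> and \<open>P\<^sub>1\<close>, in the outer case
  both are \<open>Q\<close>.  Thus the embeddings are related by a linear map on a nonempty open set, and by
  continuity everywhere.\<close>

section \<open>Polynomials in finitely many variables\<close>

text \<open>The fixed fields are independent of the embedding because a Galois extension is
  recovered from its group: pullback identifies the function field of the image with that of
  \<open>X\<close>, and the field of the projection from a Galois point becomes exactly the subfield
  of k(X) fixed by the given group. Mutual rationality yields a Moebius transformation by comparing
  degrees of polynomials in one variable. This needs generators that take infinitely many values.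
  Here the degree, at least 2 since \<open>card G1 \<ge> 3\<close>, enters: an irreducible form of
  such a degree cannot define a subset of a line, so no affine coordinate is constant on the curve.
  Two obstacles shape the rest. Identities of rational functions hold only on unspecified open sets;
  they are treated as properties holding eventually along a filter. And homogeneous coordinates are
  representatives chosen arbitrarily at each point, so only relations homogeneous in each
  representative make sense. Hence every relation to be extended to all of \<open>X\<close> is
  brought into bilinear form: the Moebius relation before it is evaluated at a pole, and the final
  proportionality of vectors as the vanishing of 2x2 minors.\<close>

lemma mp_eval_superset:
  assumes "finite K" "Poly_Mapping.keys F \<subseteq> K"
  shows "mp_eval F v = (\<Sum>m\<in>K. Poly_Mapping.lookup F m * (\<Prod>i\<in>UNIV. v $ i ^ Poly_Mapping.lookup m i))"
  unfolding mp_eval_def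
  by (rule sum.mono_neutral_left) (use assms in \<open>auto simp: in_keys_iff\<close>)

lemma mp_eval_zero [simp]: "mp_eval 0 v = 0"
  by (simp add: mp_eval_def)

lemma mp_eval_add [simp]: "mp_eval (F + G) v = mp_eval F v + mp_eval G v"
proof -
  let ?K = "Poly_Mapping.keys F \<union> Poly_Mapping.keys G"
  have "Poly_Mapping.keys (F + G) \<subseteq> ?K" by (rule Poly_Mapping.keys_add)
  then show ?thesis
    by (simp add: mp_eval_superset[of ?K] lookup_add sum.distrib distrib_right)
qed

lemma mp_eval_sum [simp]: "mp_eval (\<Sum>i\<in>I. F i) v = (\<Sum>i\<in>I. mp_eval (F i) v)"
  by (induction I rule: infinite_finite_induct) auto

lemma mp_eval_single [simp]:
  "mp_eval (Poly_Mapping.single m a) v = a * (\<Prod>i\<in>UNIV. v $ i ^ Poly_Mapping.lookup m i)"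
  by (simp add: mp_eval_superset[of "{m}"])

lemma mp_eval_one [simp]: "mp_eval 1 v = 1"
  using mp_eval_single[of 0 1 v] by simp

lemma mpoly_as_sum:
  "F = (\<Sum>m\<in>Poly_Mapping.keys F. Poly_Mapping.single m (Poly_Mapping.lookup F m))"
  by (rule poly_mapping_eqI) (auto simp: lookup_sum lookup_single when_def in_keys_iff)

lemma mp_eval_mult [simp]: "mp_eval (F * G) v = mp_eval F v * mp_eval G v"
proof -
  have "mp_eval ((\<Sum>m\<in>Poly_Mapping.keys F. Poly_Mapping.single m (Poly_Mapping.lookup F m)) *
          (\<Sum>m\<in>Poly_Mapping.keys G. Poly_Mapping.single m (Poly_Mapping.lookup G m))) v =
        mp_eval F v * mp_eval G v"
    by (simp add: sum_product mult_single lookup_add power_add prod.distrib mp_eval_def[of F] mp_eval_def[of G] algebra_simps)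
  then show ?thesis
    by (simp flip: mpoly_as_sum)
qed

lemma mp_eval_prod [simp]: "mp_eval (\<Prod>i\<in>I. F i) v = (\<Prod>i\<in>I. mp_eval (F i) v)"
  by (induction I rule: infinite_finite_induct) auto

lemma mp_eval_power [simp]: "mp_eval (F ^ n) v = mp_eval F v ^ n"
  by (induction n) auto

lemma mp_eval_diff [simp]: "mp_eval (F - G) v = mp_eval F v - mp_eval G v"
  using mp_eval_add[of "F - G" G v] by (simp del: mp_eval_add add: eq_diff_eq)

lemma homogeneous_zero [simp]: "homogeneous d 0"
  by (simp add: homogeneous_def)

lemma homogeneous_add: "homogeneous d F \<Longrightarrow> homogeneous d G \<Longrightarrow> homogeneous d (F + G)"
  using Poly_Mapping.keys_add[of F G] by (auto simp: homogeneous_def)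

lemma homogeneous_diff: "homogeneous d F \<Longrightarrow> homogeneous d G \<Longrightarrow> homogeneous d (F - G)"
  using keys_diff[of F G] by (auto simp: homogeneous_def)

lemma homogeneous_sum: "(\<And>i. i \<in> I \<Longrightarrow> homogeneous d (F i)) \<Longrightarrow> homogeneous d (\<Sum>i\<in>I. F i)"
  by (induction I rule: infinite_finite_induct) (auto intro: homogeneous_add)

lemma homogeneous_mult:
  assumes "homogeneous d F" "homogeneous e G" shows "homogeneous (d + e) (F * G)"
  unfolding homogeneous_def
proof
  fix m assume "m \<in> Poly_Mapping.keys (F * G)"
  then obtain a b where "m = a + b" "a \<in> Poly_Mapping.keys F" "b \<in> Poly_Mapping.keys G"
    using Poly_Mapping.keys_mult[of F G] by blast
  then show "(\<Sum>i\<in>UNIV. Poly_Mapping.lookup m i) = d + e"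
    using assms by (simp add: homogeneous_def lookup_add sum.distrib)
qed

lemma homogeneous_single:
  "(\<Sum>i\<in>UNIV. Poly_Mapping.lookup m i) = d \<Longrightarrow> homogeneous d (Poly_Mapping.single m a)"
  by (auto simp: homogeneous_def)

lemma homogeneous_one: "homogeneous 0 1"
  using homogeneous_single[of 0 0 1] by simp

lemma homogeneous_power: "homogeneous d F \<Longrightarrow> homogeneous (n * d) (F ^ n)"
  by (induction n) (auto intro: homogeneous_mult homogeneous_one)

lemma homogeneous_prod:
  "(\<And>i. i \<in> I \<Longrightarrow> homogeneous (d i) (F i)) \<Longrightarrow> homogeneous (\<Sum>i\<in>I. d i) (\<Prod>i\<in>I. F i)"
  by (induction I rule: infinite_finite_induct) (auto intro: homogeneous_mult homogeneous_one)

lemma mp_eval_scale: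
  assumes "homogeneous d F" shows "mp_eval F (c *s v) = c ^ d * mp_eval F v"
  using assms unfolding mp_eval_def homogeneous_def sum_distrib_left
  by (intro sum.cong refl)
     (auto simp: power_mult_distrib prod.distrib simp flip: power_sum)

text \<open>\<open>Poly_Mapping.single 0 a\<close> is the constant polynomial \<open>a\<close>,
  since the exponent vector 0 is the empty monomial.\<close>

definition mp_subst :: "('n \<Rightarrow> ('k, 'm) mpoly) \<Rightarrow> ('k::field, 'n::finite) mpoly \<Rightarrow> ('k, 'm::finite) mpoly"
  where "mp_subst G F = (\<Sum>m\<in>Poly_Mapping.keys F. Poly_Mapping.single 0 (Poly_Mapping.lookup F m) *
     (\<Prod>i\<in>UNIV. G i ^ Poly_Mapping.lookup m i))"

lemma mp_eval_subst: "mp_eval (mp_subst G F) v = mp_eval F (\<chi> i. mp_eval (G i) v)"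
  by (simp add: mp_subst_def mp_eval_def[of F])

text \<open>Keeps the pullback of a form along a map given by forms of equal degree a form, which is
  what makes preimages of Zariski open sets open.\<close>

lemma homogeneous_subst:
  assumes "homogeneous d F" "\<And>i. homogeneous e (G i)"
  shows "homogeneous (d * e) (mp_subst G F)"
  unfolding mp_subst_def
proof (rule homogeneous_sum)
  fix m assume m: "m \<in> Poly_Mapping.keys F"
  have "homogeneous (0 + (\<Sum>i\<in>UNIV. Poly_Mapping.lookup m i * e)) (Poly_Mapping.single 0 (Poly_Mapping.lookup F m) *
     (\<Prod>i\<in>UNIV. G i ^ Poly_Mapping.lookup m i))"
    by (intro homogeneous_mult homogeneous_single homogeneous_prod homogeneous_power assms) auto
  moreover have "(\<Sum>i\<in>UNIV. Poly_Mapping.lookup m i * e) = d * e"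
    using assms(1) m by (simp add: homogeneous_def flip: sum_distrib_right)
  ultimately show "homogeneous (d * e) (Poly_Mapping.single 0 (Poly_Mapping.lookup F m) *
     (\<Prod>i\<in>UNIV. G i ^ Poly_Mapping.lookup m i))" by simp
qed

section \<open>Linear forms given by coefficient vectors\<close>

definition dot :: "'k::field ^ 'n::finite \<Rightarrow> 'k ^ 'n \<Rightarrow> 'k" where
  "dot a v = (\<Sum>i\<in>UNIV. a $ i * v $ i)"

lemma dot_add_left: "dot (a + b) v = dot a v + dot b v"
  by (simp add: dot_def sum.distrib distrib_right)

lemma dot_smult_left: "dot (c *s a) v = c * dot a v"
  by (simp add: dot_def sum_distrib_left mult.assoc)

lemma dot_add_right: "dot a (v + w) = dot a v + dot a w"
  by (simp add: dot_def sum.distrib distrib_left)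

lemma dot_smult_right: "dot a (c *s v) = c * dot a v"
  by (simp add: dot_def sum_distrib_left algebra_simps)

lemma dot_zero_right [simp]: "dot a 0 = 0"
  by (simp add: dot_def)

lemma dot_axis_right: "dot a (axis i 1) = a $ i"
  by (simp add: dot_def axis_def if_distrib cong: if_cong)

lemma dot_axis_left: "dot (axis i 1) v = v $ i"
  by (simp add: dot_def axis_def if_distrib[of "\<lambda>x. x * _"] cong: if_cong)

lemma matrix_vector_mult_nth_dot: "(A *v v) $ i = dot (A $ i) v"
  by (simp add: matrix_vector_mult_def dot_def)

definition linear_form :: "'k::field ^ 'n::finite \<Rightarrow> ('k, 'n) mpoly" where
  "linear_form a = (\<Sum>i\<in>UNIV. Poly_Mapping.single (Poly_Mapping.single i 1) (a $ i))"

lemma mp_eval_linear_form [simp]: "mp_eval (linear_form a) v = dot a v"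
proof -
  have "(\<Prod>j\<in>UNIV. v $ j ^ Poly_Mapping.lookup (Poly_Mapping.single i (1::nat)) j) = v $ i" for i :: 'b
    by (simp add: lookup_single when_def if_distrib[of "\<lambda>n. _ ^ n"] cong: if_cong)
  then show ?thesis by (simp add: linear_form_def dot_def)
qed

lemma homogeneous_linear_form: "homogeneous 1 (linear_form a)"
  unfolding linear_form_def
  by (intro homogeneous_sum homogeneous_single) (simp add: lookup_single when_def)

text \<open>The restriction of \<open>F\<close> to the curve parametrized by the polynomials
  \<open>q i\<close>. It lets root counting in one variable decide questions about forms.\<close>

definition mp_to_poly :: "('n \<Rightarrow> 'k poly) \<Rightarrow> ('k::field, 'n::finite) mpoly \<Rightarrow> 'k poly" where
  "mp_to_poly q F =
     (\<Sum>m\<in>Poly_Mapping.keys F. Polynomial.smult (Poly_Mapping.lookup F m) (\<Prod>i\<in>UNIV. q i ^ Poly_Mapping.lookup m i))"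

lemma poly_mp_to_poly: "poly (mp_to_poly q F) x = mp_eval F (\<chi> i. poly (q i) x)"
  by (simp add: mp_to_poly_def mp_eval_def poly_sum poly_prod)

text \<open>The exceptional set \<open>E\<close> absorbs parameter values, usually 0, at which a
  rescaling would divide by zero.\<close>

lemma poly_eq_0_finite_exceptions:
  fixes p :: "'k::field poly"
  assumes "infinite (UNIV :: 'k set)" "finite E" "\<And>x. x \<notin> E \<Longrightarrow> poly p x = 0"
  shows "p = 0"
proof (rule ccontr)
  assume "p \<noteq> 0"
  then have "finite ({x. poly p x = 0} \<union> E)" using assms(2) by (simp add: poly_roots_finite)
  moreover have "{x. poly p x = 0} \<union> E = UNIV" using assms(3) by auto
  ultimately show False using assms(1) by simp
qed

text \<open>Over a finite field the product of all \<open>x - a\<close>, increased by 1, takes only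
  the value 1 and so has no root.\<close>

lemma infinite_UNIV_alg_closed: "infinite (UNIV :: 'k::alg_closed_field set)"
proof
  assume fin: "finite (UNIV :: 'k set)"
  let ?p = "(\<Prod>a\<in>(UNIV :: 'k set). [:- a, 1:])"
  have "degree ?p = (\<Sum>a\<in>(UNIV :: 'k set). 1)"
    by (subst degree_prod_eq_sum_degree) auto
  moreover have "card (UNIV :: 'k set) > 0" using fin by (simp add: card_gt_0_iff)
  ultimately have d: "degree ?p > 0" by simp
  then have "degree (?p + 1) > 0"
    by (subst degree_add_eq_left) auto
  then obtain x where "poly (?p + 1) x = 0"
    using alg_closed_imp_poly_has_root by blast
  moreover have "poly ?p x = 0"
    using fin by (auto simp: poly_prod)
  ultimately show False by simp
qed

lemma digit_inject:
  fixes a x N :: nat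
  assumes "a < N" "a' < N" "a + N * x = a' + N * x'"
  shows "a = a' \<and> x = x'"
proof -
  have "(a + N * x) mod N = (a' + N * x') mod N" "(a + N * x) div N = (a' + N * x') div N"
    using assms(3) by auto
  then show ?thesis using assms(1,2) by simp
qed

text \<open>Kronecker substitution turns distinct monomials into distinct powers of one variable.\<close>

lemma mp_eval_eq_0_imp_eq_0:
  fixes F :: "('k::field, 3) mpoly"
  assumes inf: "infinite (UNIV :: 'k set)" and zero: "\<And>v. mp_eval F v = 0"
  shows "F = 0"
proof -
  define E where "E = (\<Union>m\<in>Poly_Mapping.keys F. Poly_Mapping.lookup m ` (UNIV :: 3 set))"
  have "finite E" unfolding E_def by auto
  then obtain N where N: "\<And>e. e \<in> E \<Longrightarrow> e < N"
    by (meson finite_nat_set_iff_bounded)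
  \<comment> \<open>The exponents in \<open>m\<close> are all below \<open>N\<close>, so they are
    the base-\<open>N\<close> digits of \<open>ex m\<close>. The substitution \<open>q\<close> below
    replaces the three variables by t, t^N and t^(N*N).\<close>
  define ex where "ex m = Poly_Mapping.lookup m 1 + N * (Poly_Mapping.lookup m 2 + N * Poly_Mapping.lookup m (3::3))" for m :: "3 \<Rightarrow>\<^sub>0 nat"
  define q where "q i = (if i = 1 then Polynomial.monom 1 1 else if i = 2 then Polynomial.monom 1 N else Polynomial.monom (1::'k) (N * N))" for i :: 3
  have mono: "(\<Prod>i\<in>UNIV. q i ^ Poly_Mapping.lookup m i) = Polynomial.monom 1 (ex m)" for m
  proof -
    have "(\<Prod>i\<in>UNIV. q i ^ Poly_Mapping.lookup m i) = q 1 ^ Poly_Mapping.lookup m 1 * (q 2 ^ Poly_Mapping.lookup m 2 * q 3 ^ Poly_Mapping.lookup m 3)"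
      unfolding UNIV_3 by simp
    also have "\<dots> = Polynomial.monom 1 (Poly_Mapping.lookup m 1 + (N * Poly_Mapping.lookup m 2 + N * N * Poly_Mapping.lookup m 3))"
      unfolding q_def by (simp add: monom_power mult_monom)
    also have "Poly_Mapping.lookup m 1 + (N * Poly_Mapping.lookup m 2 + N * N * Poly_Mapping.lookup m 3) = ex m"
      by (simp add: ex_def distrib_left)
    finally show ?thesis .
  qed
  have inj: "inj_on ex (Poly_Mapping.keys F)"
  proof (rule inj_onI)
    fix m m' assume m: "m \<in> Poly_Mapping.keys F" "m' \<in> Poly_Mapping.keys F" "ex m = ex m'"
    then have "\<And>i. Poly_Mapping.lookup m i < N" "\<And>i. Poly_Mapping.lookup m' i < N" using N unfolding E_def by auto
    then have "Poly_Mapping.lookup m 1 = Poly_Mapping.lookup m' 1 \<and> Poly_Mapping.lookup m 2 = Poly_Mapping.lookup m' 2 \<and> Poly_Mapping.lookup m 3 = Poly_Mapping.lookup m' 3"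
      using m(3) digit_inject[of "Poly_Mapping.lookup m 1" N "Poly_Mapping.lookup m' 1"] digit_inject[of "Poly_Mapping.lookup m 2" N "Poly_Mapping.lookup m' 2"]
      unfolding ex_def by metis
    then have "\<forall>i. Poly_Mapping.lookup m i = Poly_Mapping.lookup m' i" unfolding forall_3 by blast
    then show "m = m'" by (intro poly_mapping_eqI) auto
  qed
  have "mp_to_poly q F = 0"
    by (rule poly_eq_0_finite_exceptions[OF inf, of "{}"]) (auto simp: poly_mp_to_poly zero)
  then have *: "(\<Sum>m\<in>Poly_Mapping.keys F. Polynomial.smult (Poly_Mapping.lookup F m) (Polynomial.monom 1 (ex m))) = 0"
    by (simp add: mp_to_poly_def mono)
  have "Poly_Mapping.lookup F m = 0" if m: "m \<in> Poly_Mapping.keys F" for m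
  proof -
    have "0 = Polynomial.coeff (\<Sum>m\<in>Poly_Mapping.keys F. Polynomial.smult (Poly_Mapping.lookup F m) (Polynomial.monom 1 (ex m))) (ex m)"
      by (simp add: *)
    also have "\<dots> = (\<Sum>m'\<in>Poly_Mapping.keys F. if m' = m then Poly_Mapping.lookup F m' else 0)"
      unfolding coeff_sum using inj m by (intro sum.cong refl) (auto simp: inj_on_def)
    also have "\<dots> = Poly_Mapping.lookup F m" using m by simp
    finally show ?thesis by simp
  qed
  then show ?thesis by (intro poly_mapping_eqI) (auto simp: in_keys_iff)
qed

section \<open>Generic points and morphisms\<close>

lemma rep_pspace_nonzero [simp]: "rep_pspace P \<noteq> 0"
  using Quotient_rep_reflp[OF Quotient_pspace, of P] by (simp add: proportional_def)

lemma abs_rep_pspace [simp]: "abs_pspace (rep_pspace P) = P"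
  by (rule Quotient_abs_rep[OF Quotient_pspace])

lemma proportional_refl: "v \<noteq> 0 \<Longrightarrow> proportional v v"
  unfolding proportional_def by (intro conjI exI[of _ 1]) auto

lemma abs_pspace_eq_iff:
  assumes "v \<noteq> 0" "w \<noteq> 0"
  shows "abs_pspace v = abs_pspace w \<longleftrightarrow> (\<exists>c. c \<noteq> 0 \<and> w = c *s v)"
  using Quotient_rel[OF Quotient_pspace, of v w] assms proportional_refl
  by (auto simp: proportional_def)

text \<open>The factor \<open>c\<close> is all that is unknown about a chosen representative; every
  later computation has to be insensitive to it.\<close>

lemma rep_abs_pspace:
  assumes "v \<noteq> 0" obtains c where "c \<noteq> 0" "rep_pspace (abs_pspace v) = c *s v"
  using abs_pspace_eq_iff[of v "rep_pspace (abs_pspace v)"] assms by auto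

lemma abs_pspace_smult [simp]: "c \<noteq> 0 \<Longrightarrow> v \<noteq> 0 \<Longrightarrow> abs_pspace (c *s v) = abs_pspace v"
  by (subst eq_commute) (auto simp: abs_pspace_eq_iff vector_mul_eq_0)

lemma mp_eval_scale_eq_0_iff:
  assumes "homogeneous d F" "c \<noteq> 0"
  shows "mp_eval F (c *s v) = 0 \<longleftrightarrow> mp_eval F v = 0"
  using assms by (simp add: mp_eval_scale)

section \<open>Zariski open sets and generic validity\<close>

lemma zariski_open_iff:
  "zariski_open U \<longleftrightarrow>
     (\<exists>S. (\<forall>F\<in>S. \<exists>d. homogeneous d F) \<and> U = {P. \<exists>F\<in>S. mp_eval F (rep_pspace P) \<noteq> 0})"
proof -
  have "- U = zero_locus S \<longleftrightarrow> U = {P. \<exists>F\<in>S. mp_eval F (rep_pspace P) \<noteq> 0}" for S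
    by (auto simp: zero_locus_def)
  then show ?thesis by (simp add: zariski_open_def zariski_closed_def)
qed

lemma zariski_open_nonzero:
  assumes "homogeneous d F" shows "zariski_open {P. mp_eval F (rep_pspace P) \<noteq> 0}"
  unfolding zariski_open_iff by (rule exI[of _ "{F}"]) (use assms in auto)

lemma zariski_open_UNIV: "zariski_open UNIV"
  using zariski_open_nonzero[OF homogeneous_one] by simp

text \<open>A product of two forms is nonzero at a point exactly if both factors are, so the
  products of one form from each family define the intersection.\<close>

lemma zariski_open_Int:
  assumes "zariski_open U" "zariski_open V" shows "zariski_open (U \<inter> V)"
proof -
  from assms obtain S T where S: "\<forall>F\<in>S. \<exists>d. homogeneous d F" "U = {P. \<exists>F\<in>S. mp_eval F (rep_pspace P) \<noteq> 0}"
    and T: "\<forall>F\<in>T. \<exists>d. homogeneous d F" "V = {P. \<exists>F\<in>T. mp_eval F (rep_pspace P) \<noteq> 0}"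
    unfolding zariski_open_iff by blast
  have "\<forall>H\<in>{F * G | F G. F \<in> S \<and> G \<in> T}. \<exists>d. homogeneous d H"
    using S(1) T(1) homogeneous_mult by blast
  moreover have "U \<inter> V = {P. \<exists>H\<in>{F * G | F G. F \<in> S \<and> G \<in> T}. mp_eval H (rep_pspace P) \<noteq> 0}"
    unfolding S(2) T(2) by (auto simp del: mp_eval_mult) (force, auto)
  ultimately show ?thesis unfolding zariski_open_iff by blast
qed

text \<open>A substitute for the generic point of an irreducible \<open>X\<close>: eventual truth
  along this filter is truth on some nonempty open subset, and the filter rules take care of
  intersecting such subsets.\<close>

definition generic :: "('k::field, 'n::finite) pspace set \<Rightarrow> ('k, 'n) pspace filter" where
  "generic X = (INF U\<in>{U. zariski_open U \<and> U \<inter> X \<noteq> {}}. principal (U \<inter> X))"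

lemma irreducible_open_meet:
  assumes "irreducible_set X" "zariski_open U" "zariski_open V" "U \<inter> X \<noteq> {}" "V \<inter> X \<noteq> {}"
  shows "U \<inter> V \<inter> X \<noteq> {}"
proof
  assume "U \<inter> V \<inter> X = {}"
  then have "X \<subseteq> - U \<union> - V" by auto
  then have "X \<subseteq> - U \<or> X \<subseteq> - V"
    using assms(1-3) unfolding irreducible_set_def zariski_open_def by blast
  then show False using assms(4,5) by auto
qed

text \<open>The sets generating the filter form a filter base because nonempty open subsets of an
  irreducible set meet.\<close>

lemma eventually_generic:
  assumes "irreducible_set X"
  shows "eventually P (generic X) \<longleftrightarrow> (\<exists>U. zariski_open U \<and> U \<inter> X \<noteq> {} \<and> (\<forall>Q\<in>U \<inter> X. P Q))"
proof -
  let ?B = "{U. zariski_open U \<and> U \<inter> X \<noteq> {}}"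
  have "UNIV \<in> ?B" using assms zariski_open_UNIV by (auto simp: irreducible_set_def)
  moreover have "\<exists>W\<in>?B. principal (W \<inter> X) \<le> inf (principal (U \<inter> X)) (principal (V \<inter> X))"
    if "U \<in> ?B" "V \<in> ?B" for U V
    by (rule bexI[of _ "U \<inter> V"])
       (use that irreducible_open_meet[OF assms, of U V] zariski_open_Int in auto)
  ultimately show ?thesis unfolding generic_def
    by (subst eventually_INF_base) (auto simp: eventually_principal)
qed

lemma generic_nontrivial: "irreducible_set X \<Longrightarrow> generic X \<noteq> bot"
  unfolding trivial_limit_def by (subst eventually_generic) auto

lemma eventually_generic_in: "irreducible_set X \<Longrightarrow> eventually (\<lambda>Q. Q \<in> X) (generic X)"
  by (subst eventually_generic) (use zariski_open_UNIV in \<open>auto simp: irreducible_set_def\<close>)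

lemma eventually_generic_open:
  "irreducible_set X \<Longrightarrow> zariski_open U \<Longrightarrow> U \<inter> X \<noteq> {} \<Longrightarrow> eventually (\<lambda>Q. Q \<in> U) (generic X)"
  by (subst eventually_generic) auto

text \<open>Openness in the subspace topology, stated pointwise: morphisms are given by forms only
  locally, and this way the local open sets need not be assembled into one complement of a zero
  locus.\<close>

definition rel_open :: "('k::field, 'n::finite) pspace set \<Rightarrow> ('k, 'n) pspace set \<Rightarrow> bool" where
  "rel_open S W \<longleftrightarrow> (\<forall>P\<in>W. \<exists>U. zariski_open U \<and> P \<in> U \<and> U \<inter> S \<subseteq> W)"

lemma eventually_rel_open:
  assumes "irreducible_set X" "rel_open X W" "P \<in> W" "P \<in> X"
  shows "eventually (\<lambda>Q. Q \<in> W) (generic X)"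
  using assms unfolding eventually_generic[OF assms(1)] rel_open_def by blast

text \<open>Rational functions are in general not defined everywhere, so an identity known
  generically is extended to all of \<open>X\<close> after clearing denominators.\<close>

lemma generic_identity:
  assumes "irreducible_set X" "rel_open X {Q \<in> X. h Q \<noteq> h' Q}"
    and "eventually (\<lambda>Q. h Q = h' Q) (generic X)" and "P \<in> X"
  shows "h P = h' P"
proof (rule ccontr)
  assume "h P \<noteq> h' P"
  then have "eventually (\<lambda>Q. Q \<in> {Q \<in> X. h Q \<noteq> h' Q}) (generic X)"
    using assms eventually_rel_open by blast
  with assms(3) have "eventually (\<lambda>Q. False) (generic X)"
    by eventually_elim auto
  then show False using generic_nontrivial[OF assms(1)] by (simp add: trivial_limit_def)
qed

section \<open>Morphisms in local homogeneous coordinates\<close>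

lemma morphism_on_local:
  fixes \<phi> :: "('k::field, 'n::finite) pspace \<Rightarrow> ('k, 'm::finite) pspace"
  assumes "morphism_on S \<phi>" "P \<in> S"
  obtains U d and F :: "'m \<Rightarrow> ('k, 'n) mpoly"
  where "zariski_open U" "P \<in> U" "\<And>j. homogeneous d (F j)"
    "\<And>Q. Q \<in> U \<Longrightarrow> Q \<in> S \<Longrightarrow>
       \<exists>c. c \<noteq> 0 \<and> rep_pspace (\<phi> Q) = c *s (\<chi> j. mp_eval (F j) (rep_pspace Q))"
proof -
  from assms obtain U d and F :: "'m \<Rightarrow> ('k, 'n) mpoly"
    where *: "zariski_open U" "P \<in> U" "\<forall>j. homogeneous d (F j)"
      "\<forall>Q\<in>U \<inter> S. (\<chi> j. mp_eval (F j) (rep_pspace Q)) \<noteq> 0 \<and>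
           \<phi> Q = abs_pspace (\<chi> j. mp_eval (F j) (rep_pspace Q))"
    unfolding morphism_on_def by blast
  show ?thesis
    by (rule that[of U d F]) (use * in \<open>auto elim!: rep_abs_pspace\<close>)
qed

lemma rel_open_form:
  assumes "morphism_on S \<phi>" "homogeneous e H"
  shows "rel_open S {Q \<in> S. mp_eval H (rep_pspace (\<phi> Q)) \<noteq> 0}"
  unfolding rel_open_def
proof
  fix P assume P: "P \<in> {Q \<in> S. mp_eval H (rep_pspace (\<phi> Q)) \<noteq> 0}"
  then obtain U d F where U: "zariski_open U" "P \<in> U" "\<And>j. homogeneous d (F j)"
    "\<And>Q. Q \<in> U \<Longrightarrow> Q \<in> S \<Longrightarrow>
       \<exists>c. c \<noteq> 0 \<and> rep_pspace (\<phi> Q) = c *s (\<chi> j. mp_eval (F j) (rep_pspace Q))"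
    using morphism_on_local[OF assms(1), of P] by blast
  let ?K = "mp_subst F H"
  have iff: "mp_eval ?K (rep_pspace Q) \<noteq> 0 \<longleftrightarrow> mp_eval H (rep_pspace (\<phi> Q)) \<noteq> 0"
    if "Q \<in> U" "Q \<in> S" for Q
    using U(4)[OF that] mp_eval_scale_eq_0_iff[OF assms(2)] by (auto simp: mp_eval_subst)
  have "zariski_open (U \<inter> {Q. mp_eval ?K (rep_pspace Q) \<noteq> 0})"
    using homogeneous_subst[OF assms(2) U(3)] by (intro zariski_open_Int zariski_open_nonzero U(1))
  then show "\<exists>U. zariski_open U \<and> P \<in> U \<and> U \<inter> S \<subseteq> {Q \<in> S. mp_eval H (rep_pspace (\<phi> Q)) \<noteq> 0}"
    using P U(2) iff by (intro exI[of _ "U \<inter> {Q. mp_eval ?K (rep_pspace Q) \<noteq> 0}"]) auto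
qed

lemma rel_open_vimage:
  assumes "morphism_on S \<phi>" "zariski_open V"
  shows "rel_open S {Q \<in> S. \<phi> Q \<in> V}"
  unfolding rel_open_def
proof
  fix P assume P: "P \<in> {Q \<in> S. \<phi> Q \<in> V}"
  from assms(2) obtain T where T: "\<forall>F\<in>T. \<exists>d. homogeneous d F"
    "V = {P. \<exists>F\<in>T. mp_eval F (rep_pspace P) \<noteq> 0}"
    unfolding zariski_open_iff by blast
  with P obtain H e where H: "H \<in> T" "homogeneous e H" "mp_eval H (rep_pspace (\<phi> P)) \<noteq> 0" by blast
  have "{Q \<in> S. mp_eval H (rep_pspace (\<phi> Q)) \<noteq> 0} \<subseteq> {Q \<in> S. \<phi> Q \<in> V}"
    using H T(2) by auto
  then show "\<exists>U. zariski_open U \<and> P \<in> U \<and> U \<inter> S \<subseteq> {Q \<in> S. \<phi> Q \<in> V}"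
    using rel_open_form[OF assms(1) H(2)] P H(3) unfolding rel_open_def by blast
qed

text \<open>Both sides are linear in each representative, so a change of representatives multiplies
  their difference by a nonzero factor, and the local forms of both morphisms can be substituted.
  Cross-multiplied relations between two embeddings have this shape, with rows of matrices as
  \<open>a\<close>, \<open>a'\<close>, \<open>b\<close>, \<open>b'\<close>.\<close>

lemma rel_open_bilinear:
  assumes "morphism_on S \<phi>" "morphism_on S \<phi>'"
  shows "rel_open S {Q \<in> S. dot a (rep_pspace (\<phi> Q)) * dot a' (rep_pspace (\<phi>' Q)) \<noteq>
     dot b (rep_pspace (\<phi> Q)) * dot b' (rep_pspace (\<phi>' Q))}" (is "rel_open S ?W")
  unfolding rel_open_def
proof
  fix P assume P: "P \<in> ?W"
  then obtain U d F where U: "zariski_open U" "P \<in> U" "\<And>j. homogeneous d (F j)"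
    "\<And>Q. Q \<in> U \<Longrightarrow> Q \<in> S \<Longrightarrow>
       \<exists>c. c \<noteq> 0 \<and> rep_pspace (\<phi> Q) = c *s (\<chi> j. mp_eval (F j) (rep_pspace Q))"
    using morphism_on_local[OF assms(1), of P] by blast
  from P obtain U' d' F' where U': "zariski_open U'" "P \<in> U'" "\<And>j. homogeneous d' (F' j)"
    "\<And>Q. Q \<in> U' \<Longrightarrow> Q \<in> S \<Longrightarrow>
       \<exists>c. c \<noteq> 0 \<and> rep_pspace (\<phi>' Q) = c *s (\<chi> j. mp_eval (F' j) (rep_pspace Q))"
    using morphism_on_local[OF assms(2), of P] by blast
  let ?K = "mp_subst F (linear_form a) * mp_subst F' (linear_form a') -
     mp_subst F (linear_form b) * mp_subst F' (linear_form b')"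
  have hom: "homogeneous (1 * d + 1 * d') ?K"
    by (intro homogeneous_diff homogeneous_mult homogeneous_subst homogeneous_linear_form U(3) U'(3))
  have iff: "mp_eval ?K (rep_pspace Q) \<noteq> 0 \<longleftrightarrow> Q \<in> ?W"
    if Q: "Q \<in> U \<inter> U'" "Q \<in> S" for Q
  proof -
    obtain c c' where c: "c \<noteq> 0" "rep_pspace (\<phi> Q) = c *s (\<chi> j. mp_eval (F j) (rep_pspace Q))"
      and c': "c' \<noteq> 0" "rep_pspace (\<phi>' Q) = c' *s (\<chi> j. mp_eval (F' j) (rep_pspace Q))"
      using U(4)[of Q] U'(4)[of Q] Q by blast
    then have "dot a (rep_pspace (\<phi> Q)) * dot a' (rep_pspace (\<phi>' Q)) -
        dot b (rep_pspace (\<phi> Q)) * dot b' (rep_pspace (\<phi>' Q)) =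
        c * c' * mp_eval ?K (rep_pspace Q)"
      by (simp add: dot_smult_right mp_eval_subst algebra_simps)
    then have "dot a (rep_pspace (\<phi> Q)) * dot a' (rep_pspace (\<phi>' Q)) =
        dot b (rep_pspace (\<phi> Q)) * dot b' (rep_pspace (\<phi>' Q)) \<longleftrightarrow> mp_eval ?K (rep_pspace Q) = 0"
      using c(1) c'(1) by (metis eq_iff_diff_eq_0 mult_eq_0_iff)
    then show ?thesis using Q(2) by simp
  qed
  have "zariski_open (U \<inter> U' \<inter> {Q. mp_eval ?K (rep_pspace Q) \<noteq> 0})"
    by (intro zariski_open_Int zariski_open_nonzero[OF hom] U(1) U'(1))
  then show "\<exists>U. zariski_open U \<and> P \<in> U \<and> U \<inter> S \<subseteq> ?W"
    using P U(2) U'(2) iff by (intro exI[of _ "U \<inter> U' \<inter> {Q. mp_eval ?K (rep_pspace Q) \<noteq> 0}"]) blast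
qed

lemma eventually_vimage:
  assumes "irreducible_set X" "morphism_on X \<phi>" "zariski_open U" "U \<inter> \<phi> ` X \<noteq> {}"
  shows "eventually (\<lambda>Q. \<phi> Q \<in> U) (generic X)"
proof -
  from assms(4) obtain P where "P \<in> X" "\<phi> P \<in> U" by auto
  then have "eventually (\<lambda>Q. Q \<in> {Q \<in> X. \<phi> Q \<in> U}) (generic X)"
    using eventually_rel_open[OF assms(1) rel_open_vimage[OF assms(2,3)], of P] by simp
  then show ?thesis by (rule eventually_mono) simp
qed

text \<open>If neither closed set contained the image, a generic point of \<open>X\<close> would be
  mapped into both complements at once.\<close>

lemma irreducible_image:
  assumes "irreducible_set X" "morphism_on X \<phi>" shows "irreducible_set (\<phi> ` X)"
  unfolding irreducible_set_def
proof (intro conjI allI impI)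
  show "\<phi> ` X \<noteq> {}" using assms(1) by (simp add: irreducible_set_def)
  fix Z1 Z2 assume Z: "zariski_closed Z1 \<and> zariski_closed Z2 \<and> \<phi> ` X \<subseteq> Z1 \<union> Z2"
  show "\<phi> ` X \<subseteq> Z1 \<or> \<phi> ` X \<subseteq> Z2"
  proof (rule ccontr)
    assume "\<not> ?thesis"
    then have "(- Z1) \<inter> \<phi> ` X \<noteq> {}" "(- Z2) \<inter> \<phi> ` X \<noteq> {}" by auto
    then have "eventually (\<lambda>Q. \<phi> Q \<in> - Z1) (generic X)" "eventually (\<lambda>Q. \<phi> Q \<in> - Z2) (generic X)"
      using Z by (auto intro!: eventually_vimage[OF assms] simp: zariski_open_def simp del: Compl_iff)
    then have "eventually (\<lambda>Q. False) (generic X)"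
      using eventually_generic_in[OF assms(1)] by eventually_elim (use Z in auto)
    then show False using generic_nontrivial[OF assms(1)] by (simp add: trivial_limit_def)
  qed
qed

text \<open>A morphism sends the generic point to the generic point of its image. Composition of
  limits then transfers statements valid generically on the plane curve to \<open>X\<close>.\<close>

lemma filterlim_generic_image:
  assumes "irreducible_set X" "morphism_on X \<phi>"
  shows "filterlim \<phi> (generic (\<phi> ` X)) (generic X)"
  unfolding filterlim_iff eventually_generic[OF irreducible_image[OF assms]]
proof (intro allI impI, elim exE conjE)
  fix P U assume "zariski_open U" "U \<inter> \<phi> ` X \<noteq> {}" and P: "\<forall>Q\<in>U \<inter> \<phi> ` X. P Q"
  then have "eventually (\<lambda>Q. \<phi> Q \<in> U) (generic X)" by (intro eventually_vimage[OF assms])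
  then show "eventually (\<lambda>Q. P (\<phi> Q)) (generic X)"
    using eventually_generic_in[OF assms(1)] by eventually_elim (use P in auto)
qed

section \<open>Rational functions with a rational inverse\<close>

text \<open>For \<open>degree p \<le> m\<close> this is the homogenization of \<open>p\<close> to a
  binary form of formal degree \<open>m\<close>. If the degree of \<open>p\<close> is smaller than
  \<open>m\<close>, the form is divisible by \<open>y\<close>: infinity counts as a root.\<close>

definition bform :: "nat \<Rightarrow> 'k::field poly \<Rightarrow> 'k \<Rightarrow> 'k \<Rightarrow> 'k" where
  "bform m p x y = (\<Sum>i\<le>m. Polynomial.coeff p i * x ^ i * y ^ (m - i))"

lemma poly_sum_le:
  fixes p :: "'k::field poly"
  assumes "degree p \<le> m" shows "poly p x = (\<Sum>i\<le>m. Polynomial.coeff p i * x ^ i)"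
  unfolding poly_altdef
  by (rule sum.mono_neutral_left) (use assms in \<open>auto intro: coeff_eq_0\<close>)

lemma bform_dehomogenize:
  assumes "degree p \<le> m" "y \<noteq> 0" shows "bform m p x y = y ^ m * poly p (x / y)"
  unfolding bform_def poly_sum_le[OF assms(1)] sum_distrib_left
  using assms(2) by (intro sum.cong refl) (auto simp: power_divide power_diff field_simps)

lemma bform_at_infinity: "bform m p x 0 = Polynomial.coeff p m * x ^ m"
proof -
  have "bform m p x 0 = (\<Sum>i\<le>m. if i = m then Polynomial.coeff p m * x ^ m else 0)"
    unfolding bform_def by (intro sum.cong refl) auto
  then show ?thesis by simp
qed

lemma bform_add: "bform m (p + q) x y = bform m p x y + bform m q x y"
  by (simp add: bform_def sum.distrib algebra_simps)

lemma bform_smult: "bform m (Polynomial.smult c p) x y = c * bform m p x y"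
  by (simp add: bform_def sum_distrib_left algebra_simps)

lemma bform_pCons: "bform (Suc m) (pCons 0 p) x y = x * bform m p x y"
  unfolding bform_def sum.atMost_Suc_shift sum_distrib_left by (simp add: algebra_simps)

lemma bform_Suc: "degree p \<le> m \<Longrightarrow> bform (Suc m) p x y = y * bform m p x y"
  by (simp add: bform_def coeff_eq_0 sum_distrib_left Suc_diff_le algebra_simps)

text \<open>The factor is \<open>y\<close> if the degree drops below the formal degree, that is for
  a root at infinity, and otherwise comes from an ordinary root of \<open>p\<close>.\<close>

lemma bform_linear_factor:
  fixes p :: "'k::alg_closed_field poly"
  assumes "degree p \<le> Suc m"
  obtains \<alpha> \<beta> q where "\<alpha> \<noteq> 0 \<or> \<beta> \<noteq> 0" "\<And>x y. bform (Suc m) p x y = (\<alpha> * x + \<beta> * y) * bform m q x y"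
proof (cases "degree p \<le> m")
  case True
  then show ?thesis using that[of 0 1 p] by (simp add: bform_Suc)
next
  case False
  then have deg: "degree p = Suc m" using assms by simp
  then obtain r where "poly p r = 0" using alg_closed_imp_poly_has_root[of p] by auto
  then obtain q where q: "p = [:- r, 1:] * q" by (auto simp: poly_eq_0_iff_dvd)
  then have "q \<noteq> 0" using deg by auto
  with q deg have "degree q = m" by (simp add: degree_mult_eq del: mult_pCons_left)
  moreover have "p = pCons 0 q + Polynomial.smult (- r) q" using q by simp
  ultimately show ?thesis
    using that[of 1 "- r" q] by (simp only: bform_add bform_smult bform_pCons bform_Suc order_refl)
      (simp add: algebra_simps)
qed

text \<open>A common zero with \<open>y = 0\<close> would annihilate both coefficients of index
  \<open>m\<close>; one with \<open>y \<noteq> 0\<close> would be a common root of \<open>c\<close>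
  and \<open>d\<close>.\<close>

lemma bform_no_common_zero:
  fixes c d :: "'k::field poly"
  assumes "degree c \<le> m" "degree d \<le> m" "Polynomial.coeff c m \<noteq> 0 \<or> Polynomial.coeff d m \<noteq> 0"
    and "\<And>x. \<not> (poly c x = 0 \<and> poly d x = 0)"
    and "bform m c x y = 0" "bform m d x y = 0"
  shows "x = 0 \<and> y = 0"
proof (cases "y = 0")
  case True
  then show ?thesis using assms(3,5,6) by (auto simp: bform_at_infinity)
next
  case False
  then show ?thesis using assms(4)[of "x / y"] assms(5,6)
    by (simp add: bform_dehomogenize[OF assms(1)] bform_dehomogenize[OF assms(2)])
qed

text \<open>The form \<open>bform m p\<close> with polynomials in place of its two arguments, which
  \<open>bform\<close> itself only takes from a field.\<close>

definition bform_comp :: "nat \<Rightarrow> 'k::field poly \<Rightarrow> 'k poly \<Rightarrow> 'k poly \<Rightarrow> 'k poly" where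
  "bform_comp m p a b = (\<Sum>i\<le>m. Polynomial.smult (Polynomial.coeff p i) (a ^ i * b ^ (m - i)))"

lemma poly_bform_comp: "poly (bform_comp m p a b) x = bform m p (poly a x) (poly b x)"
  by (simp add: bform_comp_def bform_def poly_sum mult.assoc)

text \<open>Each common root is split off as a linear factor, which lowers the degree of
  \<open>q\<close>; since \<open>q \<noteq> 0\<close> this ends.\<close>

lemma cancel_common_roots:
  fixes p q :: "'k::field poly"
  assumes "q \<noteq> 0"
  obtains g p' q' where "g \<noteq> 0" "p = g * p'" "q = g * q'" "\<And>x. \<not> (poly p' x = 0 \<and> poly q' x = 0)"
proof -
  have "\<exists>g p' q'. g \<noteq> 0 \<and> p = g * p' \<and> q = g * q' \<and> (\<forall>x. \<not> (poly p' x = 0 \<and> poly q' x = 0))"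
    using assms
  proof (induction "degree q" arbitrary: p q rule: less_induct)
    case less
    show ?case
    proof (cases "\<exists>r. poly p r = 0 \<and> poly q r = 0")
      case False
      then show ?thesis by (intro exI[of _ 1] exI[of _ p] exI[of _ q]) auto
    next
      case True
      then obtain r p1 q1 where r: "p = [:- r, 1:] * p1" "q = [:- r, 1:] * q1"
        by (meson dvdE poly_eq_0_iff_dvd)
      then have "q1 \<noteq> 0" using less.prems by auto
      moreover from this have "degree q1 < degree q"
        unfolding r by (subst degree_mult_eq) auto
      ultimately obtain g p' q' where g: "g \<noteq> 0" "p1 = g * p'" "q1 = g * q'"
        "\<forall>x. \<not> (poly p' x = 0 \<and> poly q' x = 0)"
        using less.hyps[of q1 p1] by blast
      from g have "[:- r, 1:] * g \<noteq> 0" "p = ([:- r, 1:] * g) * p'" "q = ([:- r, 1:] * g) * q'"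
        unfolding r by (simp_all only: mult.assoc mult_eq_0_iff) simp
      with g(4) show ?thesis by blast
    qed
  qed
  then show ?thesis using that by blast
qed

text \<open>If \<open>x = c(y)/d(y)\<close> and \<open>y = p(x)/q(x)\<close>, then homogenizing gives \<open>C(p, q) = x D(p, q)\<close> with
  \<open>C(p, q)\<close> and \<open>D(p, q)\<close> without common root.  Hence a linear factor of \<open>D\<close> becomes constant and
  one of \<open>C\<close> becomes linear in \<open>x\<close>, and these two factors determine \<open>p\<close> and \<open>q\<close>.\<close>

lemma rational_inverse_imp_Moebius:
  fixes p q c d :: "'k::alg_closed_field poly"
  assumes S: "infinite S" and inv: "\<And>x. x \<in> S \<Longrightarrow> poly q x \<noteq> 0 \<and> poly d (poly p x / poly q x) \<noteq> 0 \<and>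
     poly c (poly p x / poly q x) = x * poly d (poly p x / poly q x)"
  obtains a1 b1 c1 d1 where "c1 \<noteq> 0 \<or> d1 \<noteq> 0"
    "\<And>x. poly p x * (c1 * x + d1) = poly q x * (a1 * x + b1)"
proof -
  obtain x0 where "x0 \<in> S" using S by fastforce
  then have "q \<noteq> 0" "d \<noteq> 0" using inv[of x0] by auto
  obtain g p0 q0 where g: "g \<noteq> 0" "p = g * p0" "q = g * q0"
    "\<And>x. \<not> (poly p0 x = 0 \<and> poly q0 x = 0)"
    using cancel_common_roots[OF \<open>q \<noteq> 0\<close>] by metis
  obtain h c0 d0 where h: "h \<noteq> 0" "c = h * c0" "d = h * d0"
    "\<And>x. \<not> (poly c0 x = 0 \<and> poly d0 x = 0)"
    using cancel_common_roots[OF \<open>d \<noteq> 0\<close>] by metis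
  have nz: "q0 \<noteq> 0" "d0 \<noteq> 0" using \<open>q \<noteq> 0\<close> \<open>d \<noteq> 0\<close> g h by auto
  \<comment> \<open>A common formal degree for both forms. Taking the maximum ensures that they have
    no common zero at infinity.\<close>
  define m where "m = max (degree c0) (degree d0)"
  have m: "degree c0 \<le> m" "degree d0 \<le> m" by (auto simp: m_def)
  have lead: "Polynomial.coeff c0 m \<noteq> 0 \<or> Polynomial.coeff d0 m \<noteq> 0"
  proof (cases "degree c0 \<le> degree d0")
    case True
    then show ?thesis using nz(2) by (simp add: m_def max_def)
  next
    case False
    then have "c0 \<noteq> 0" by auto
    with False show ?thesis by (simp add: m_def max_def)
  qed
  note no_common = bform_no_common_zero[OF m lead h(4)]
  define A where "A = bform_comp m c0 p0 q0"
  define B where "B = bform_comp m d0 p0 q0"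
  \<comment> \<open>The relation, cleared of denominators, holds at infinitely many points and is
    therefore an identity of polynomials.\<close>
  have "S \<subseteq> {x. poly (A - [:0, 1:] * B) x = 0}"
  proof safe
    fix x assume x: "x \<in> S"
    define z where "z = poly p0 x / poly q0 x"
    have q0: "poly q0 x \<noteq> 0" and z: "poly p x / poly q x = z"
      using inv[OF x] g by (auto simp: z_def)
    have "poly c0 z = x * poly d0 z"
      using inv[OF x] unfolding z by (auto simp: h)
    then show "poly (A - [:0, 1:] * B) x = 0"
      using q0 by (simp add: A_def B_def poly_bform_comp bform_dehomogenize m flip: z_def)
  qed
  then have "A - [:0, 1:] * B = 0"
    using S poly_roots_finite finite_subset by blast
  then have AB: "A = [:0, 1:] * B" by simp
  \<comment> \<open>A root of \<open>B\<close> is also one of \<open>A\<close>, which is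
    \<open>x\<close> times \<open>B\<close>; then \<open>p0\<close> and \<open>q0\<close> would give
    a common zero of the two forms. So \<open>B\<close> is constant and \<open>A\<close> has degree
    1.\<close>
  have Broot: "poly B x \<noteq> 0" for x
  proof
    assume "poly B x = 0"
    moreover from this have "poly A x = 0" by (simp add: AB)
    ultimately show False
      using no_common[of "poly p0 x" "poly q0 x"] g(4)[of x] by (simp add: A_def B_def poly_bform_comp)
  qed
  then have degB: "degree B = 0" using alg_closed_imp_poly_has_root[of B] by blast
  have "B \<noteq> 0" using Broot by auto
  then have A: "A \<noteq> 0" "degree A = 1" using degB by (simp_all only: AB degree_mult_eq) auto
  have "m \<noteq> 0"
  proof
    assume "m = 0"
    then have "degree A = 0" by (simp add: A_def bform_comp_def)
    with A show False by simp
  qed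
  then obtain k where k: "m = Suc k" by (cases m) auto
  obtain \<alpha> \<beta> c' where c': "\<alpha> \<noteq> 0 \<or> \<beta> \<noteq> 0" "\<And>x y. bform m c0 x y = (\<alpha> * x + \<beta> * y) * bform k c' x y"
    using bform_linear_factor[of c0 k] m k by metis
  obtain \<gamma> \<delta> d' where d': "\<gamma> \<noteq> 0 \<or> \<delta> \<noteq> 0" "\<And>x y. bform m d0 x y = (\<gamma> * x + \<delta> * y) * bform k d' x y"
    using bform_linear_factor[of d0 k] m k by metis
  define u where "u = Polynomial.smult \<alpha> p0 + Polynomial.smult \<beta> q0"
  define v where "v = Polynomial.smult \<gamma> p0 + Polynomial.smult \<delta> q0"
  have "A = u * bform_comp k c' p0 q0" "B = v * bform_comp k d' p0 q0"
    unfolding eq_iff_diff_eq_0[of A] eq_iff_diff_eq_0[of B]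
    by (rule poly_eq_0_finite_exceptions[OF infinite_UNIV_alg_closed, of "{}"],
        simp, simp add: A_def B_def u_def v_def poly_bform_comp c' d')+
  then have uv: "degree u \<le> 1" "degree v = 0"
    using A degB \<open>B \<noteq> 0\<close> by (auto simp: degree_mult_eq)
  define \<Delta> where "\<Delta> = \<alpha> * \<delta> - \<beta> * \<gamma>"
  \<comment> \<open>With vanishing determinant the two linear factors would be proportional and
    share the zero \<open>(\<beta>, - \<alpha>)\<close>.\<close>
  have \<Delta>: "\<Delta> \<noteq> 0"
  proof
    assume "\<Delta> = 0"
    then have "bform m c0 \<beta> (- \<alpha>) = 0" "bform m d0 \<beta> (- \<alpha>) = 0"
      by (simp_all add: c' d' \<Delta>_def algebra_simps)
    then show False using no_common[of \<beta> "- \<alpha>"] c'(1) by auto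
  qed
  \<comment> \<open>Cramer's rule recovers \<open>p0\<close> and \<open>q0\<close> from
    \<open>u\<close> and \<open>v\<close>, whose degrees are at most 1.\<close>
  have "Polynomial.smult \<Delta> p0 = Polynomial.smult \<delta> u - Polynomial.smult \<beta> v"
    "Polynomial.smult \<Delta> q0 = Polynomial.smult \<alpha> v - Polynomial.smult \<gamma> u"
    by (auto simp: poly_eq_iff u_def v_def \<Delta>_def algebra_simps)
  then have "degree (Polynomial.smult \<Delta> p0) \<le> 1" "degree (Polynomial.smult \<Delta> q0) \<le> 1"
    using uv by (auto intro!: degree_diff_le order.trans[OF degree_smult_le])
  then have deg: "degree p0 \<le> 1" "degree q0 \<le> 1" using \<Delta> by simp_all
  have linear: "r = [:Polynomial.coeff r 0, Polynomial.coeff r 1:]" if "degree r \<le> 1" for r :: "'k poly"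
    using that by (auto simp: poly_eq_iff coeff_pCons coeff_eq_0 split: nat.split)
  obtain a1 b1 c1 d1 where a1: "p0 = [:b1, a1:]" and c1: "q0 = [:d1, c1:]"
    using linear deg by blast
  show ?thesis
    by (rule that[of c1 d1 a1 b1]) (use nz c1 in \<open>auto simp: g a1 c1 algebra_simps\<close>)
qed

section \<open>Plane curves that are not lines\<close>

lemma mp_eval_unit: "F dvd 1 \<Longrightarrow> mp_eval F v \<noteq> 0"
  by (metis dvdE mp_eval_mult mp_eval_one mult_zero_left zero_neq_one)

text \<open>If the curve were contained in the line of \<open>a\<close>, its form \<open>F\<close>
  would have no zero on the affine chart \<open>dot a v = 1\<close> and would be constant there. By
  homogeneity \<open>F\<close> is then a constant times the \<open>d\<close>-th power of the linear
  form, which is reducible for \<open>d \<ge> 2\<close>.\<close>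

lemma plane_degree_not_in_line:
  fixes C :: "('k::alg_closed_field, 3) pspace set"
  assumes "has_plane_degree C d" "d \<ge> 2" "a \<noteq> 0"
  shows "\<exists>Q\<in>C. dot a (rep_pspace Q) \<noteq> 0"
proof (rule ccontr)
  assume "\<not> ?thesis"
  then have in_line: "dot a (rep_pspace Q) = 0" if "Q \<in> C" for Q using that by simp
  from assms(1) obtain F where F: "irreducible F" "homogeneous d F" "C = zero_locus {F}"
    unfolding has_plane_degree_def by blast
  have zero: "dot a v = 0" if "v \<noteq> 0" "mp_eval F v = 0" for v
  proof -
    from that(1) obtain c where c: "c \<noteq> 0" "rep_pspace (abs_pspace v) = c *s v" by (rule rep_abs_pspace)
    then have "abs_pspace v \<in> C" using that(2) F by (simp add: zero_locus_def mp_eval_scale)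
    then show ?thesis using in_line c by (fastforce simp: dot_smult_right)
  qed
  from assms(3) obtain i where i: "a $ i \<noteq> 0" by (auto simp: vec_eq_iff)
  define w where "w = (1 / a $ i) *s axis i (1 :: 'k)"
  have w: "dot a w = 1" using i by (simp add: w_def dot_smult_right dot_axis_right)
  have one: "mp_eval F v = mp_eval F w" if v: "dot a v = 1" for v
  proof -
    \<comment> \<open>The restriction of \<open>F\<close> to the affine line from \<open>w\<close>
      to \<open>v\<close>, which stays inside the chart. Without roots over an algebraically closed
      field it is constant.\<close>
    define p where "p = mp_to_poly (\<lambda>i. [:w $ i, v $ i - w $ i:]) F"
    have p: "poly p s = mp_eval F (w + s *s (v - w))" for s
    proof -
      have "(\<chi> i. poly [:w $ i, v $ i - w $ i:] s) = w + s *s (v - w)" by (simp add: vec_eq_iff)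
      then show ?thesis by (simp only: p_def poly_mp_to_poly)
    qed
    have "poly p s \<noteq> 0" for s
    proof
      assume "poly p s = 0"
      moreover have one: "dot a (w + s *s (v - w)) = 1"
        using dot_add_right[of a "v - w" w] by (simp add: dot_add_right dot_smult_right v w)
      moreover from one have "w + s *s (v - w) \<noteq> 0" by (metis dot_zero_right zero_neq_one)
      ultimately show False using zero p by (metis zero_neq_one)
    qed
    then have "degree p = 0" using alg_closed_imp_poly_has_root by blast
    then obtain c where "p = [:c:]" by (rule degree_eq_zeroE)
    then have "poly p 0 = poly p 1" by simp
    then show ?thesis by (simp add: p)
  qed
  have nonzero: "mp_eval F v = dot a v ^ d * mp_eval F w" if v: "dot a v \<noteq> 0" for v
  proof -
    have "mp_eval F ((1 / dot a v) *s v) = mp_eval F w"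
      by (rule one) (use v in \<open>simp add: dot_smult_right\<close>)
    then show ?thesis using v by (simp add: mp_eval_scale[OF F(2)] field_simps)
  qed
  have "mp_eval F v = dot a v ^ d * mp_eval F w" for v
  proof (cases "dot a v = 0")
    case True
    \<comment> \<open>On the line itself one extrapolates from the points \<open>v + s *s w\<close>,
      where the linear form has the value \<open>s\<close>: the polynomial \<open>p\<close> vanishes
      for \<open>s \<noteq> 0\<close>, hence also at 0.\<close>
    define p where "p = mp_to_poly (\<lambda>i. [:v $ i, w $ i:]) F - Polynomial.monom (mp_eval F w) d"
    have p: "poly p s = mp_eval F (v + s *s w) - s ^ d * mp_eval F w" for s
    proof -
      have "(\<chi> i. poly [:v $ i, w $ i:] s) = v + s *s w" by (simp add: vec_eq_iff)
      then show ?thesis by (simp add: p_def poly_mp_to_poly poly_monom)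
    qed
    have "poly p s = 0" if "s \<noteq> 0" for s
    proof -
      have "dot a (v + s *s w) = s" by (simp add: dot_add_right dot_smult_right True w)
      with nonzero[of "v + s *s w"] that show ?thesis by (simp add: p)
    qed
    then have "p = 0"
      by (intro poly_eq_0_finite_exceptions[OF infinite_UNIV_alg_closed, of "{0}"]) auto
    then have "poly p 0 = 0" by simp
    then show ?thesis using p[of 0] True by simp
  qed (rule nonzero)
  then have eval: "mp_eval F v = dot a v ^ d * mp_eval F w" for v .
  let ?c = "Poly_Mapping.single 0 (mp_eval F w)"
  have "mp_eval (F - linear_form a ^ d * ?c) v = 0" for v
    using eval[of v] by simp
  then have "F = linear_form a ^ d * ?c"
    using mp_eval_eq_0_imp_eq_0[OF infinite_UNIV_alg_closed] by (metis right_minus_eq)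
  also have "d = Suc (d - 1)" using assms(2) by simp
  finally have "F = linear_form a * (linear_form a ^ (d - 1) * ?c)"
    by (simp only: power_Suc mult.assoc)
  then have "linear_form a dvd 1 \<or> (linear_form a ^ (d - 1) * ?c) dvd 1"
    using F(1) Factorial_Ring.irreducibleD by blast
  \<comment> \<open>Both factors vanish at the zero vector, the second because
    \<open>d - 1 > 0\<close>, whereas a unit vanishes nowhere.\<close>
  moreover have "mp_eval (linear_form a) 0 = 0" "mp_eval (linear_form a ^ (d - 1) * ?c) 0 = 0"
    using assms(2) by (simp_all add: power_0_left)
  ultimately show False using mp_eval_unit by blast
qed

lemma eventually_not_in_line:
  fixes C :: "('k::alg_closed_field, 3) pspace set"
  assumes "irreducible_set C" "has_plane_degree C d" "d \<ge> 2" "a \<noteq> 0"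
  shows "eventually (\<lambda>Q. dot a (rep_pspace Q) \<noteq> 0) (generic C)"
proof -
  obtain Q where "Q \<in> C" "dot a (rep_pspace Q) \<noteq> 0"
    using plane_degree_not_in_line[OF assms(2-4)] by blast
  then have "eventually (\<lambda>Q. Q \<in> {Q. mp_eval (linear_form a) (rep_pspace Q) \<noteq> 0}) (generic C)"
    by (intro eventually_generic_open assms zariski_open_nonzero[OF homogeneous_linear_form]) auto
  then show ?thesis by simp
qed

section \<open>Function fields\<close>

definition rational_function :: "('k::field, 'n::finite) pspace set \<Rightarrow> (('k, 'n) pspace \<Rightarrow> 'k) \<Rightarrow> bool" where
  "rational_function X f \<longleftrightarrow> (\<exists>d F G. homogeneous d F \<and> homogeneous d G \<and>
     eventually (\<lambda>Q. mp_eval G (rep_pspace Q) \<noteq> 0 \<and>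
       f Q = mp_eval F (rep_pspace Q) / mp_eval G (rep_pspace Q)) (generic X))"

text \<open>Near one point of its domain a regular function is a single fraction of forms, and this
  neighbourhood already determines the germ.\<close>

lemma carrier_function_field:
  assumes "irreducible_set X"
  shows "carrier (function_field X) = {germ X f | f. rational_function X f}"
proof -
  have "(\<exists>U. zariski_open U \<and> U \<inter> X \<noteq> {} \<and> regular_on (U \<inter> X) f) \<longleftrightarrow> rational_function X f" for f
  proof
    assume "\<exists>U. zariski_open U \<and> U \<inter> X \<noteq> {} \<and> regular_on (U \<inter> X) f"
    then obtain U P where U: "zariski_open U" "P \<in> U" "P \<in> X" "regular_on (U \<inter> X) f" by auto
    then obtain V d F G where V: "zariski_open V" "P \<in> V" "homogeneous d F" "homogeneous d G"
      "\<forall>Q\<in>V \<inter> (U \<inter> X). mp_eval G (rep_pspace Q) \<noteq> 0 \<and>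
           f Q = mp_eval F (rep_pspace Q) / mp_eval G (rep_pspace Q)"
      unfolding regular_on_def by blast
    have "zariski_open (V \<inter> U)" "V \<inter> U \<inter> X \<noteq> {}" using U V zariski_open_Int by auto
    then show "rational_function X f"
      unfolding rational_function_def eventually_generic[OF assms]
      by (intro exI[of _ d] exI[of _ F] exI[of _ G] exI[of _ "V \<inter> U"] conjI V(3,4)) (use V(5) in auto)
  next
    assume "rational_function X f"
    then obtain d F G U where U: "zariski_open U" "U \<inter> X \<noteq> {}" "homogeneous d F" "homogeneous d G"
      "\<forall>Q\<in>U \<inter> X. mp_eval G (rep_pspace Q) \<noteq> 0 \<and>
           f Q = mp_eval F (rep_pspace Q) / mp_eval G (rep_pspace Q)"
      unfolding rational_function_def eventually_generic[OF assms] by blast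
    then have "regular_on (U \<inter> X) f"
      unfolding regular_on_def by blast
    with U show "\<exists>U. zariski_open U \<and> U \<inter> X \<noteq> {} \<and> regular_on (U \<inter> X) f"
      by blast
  qed
  then show ?thesis by (simp add: function_field_def)
qed

section \<open>Germs and their pullback\<close>

lemma mem_germ_iff:
  "irreducible_set X \<Longrightarrow> g \<in> germ X f \<longleftrightarrow> eventually (\<lambda>Q. g Q = f Q) (generic X)"
  by (simp add: germ_def eventually_generic)

lemma germ_eq_iff:
  assumes "irreducible_set X"
  shows "germ X f = germ X g \<longleftrightarrow> eventually (\<lambda>Q. f Q = g Q) (generic X)"
proof
  assume "germ X f = germ X g"
  moreover have "f \<in> germ X f" by (simp add: mem_germ_iff[OF assms])
  ultimately show "eventually (\<lambda>Q. f Q = g Q) (generic X)" by (simp add: mem_germ_iff[OF assms])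
next
  assume *: "eventually (\<lambda>Q. f Q = g Q) (generic X)"
  have "h \<in> germ X f \<longleftrightarrow> h \<in> germ X g" for h
    unfolding mem_germ_iff[OF assms] by (rule eventually_cong[OF *]) simp
  then show "germ X f = germ X g" by blast
qed

text \<open>The limit hypothesis expresses dominance. It makes the germ of the composite independent
  of the representative, so the union defining \<open>pullback\<close> is a union of equal
  sets.\<close>

lemma pullback_germ:
  assumes X: "irreducible_set X" and Y: "irreducible_set Y" and lim: "filterlim \<phi> (generic Y) (generic X)"
  shows "pullback X \<phi> (germ Y f) = germ X (f \<circ> \<phi>)"
proof -
  have "germ X (g \<circ> \<phi>) = germ X (f \<circ> \<phi>)" if "g \<in> germ Y f" for g
    using that lim by (auto simp: mem_germ_iff[OF Y] germ_eq_iff[OF X] filterlim_iff)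
  moreover have "f \<in> germ Y f" by (simp add: mem_germ_iff[OF Y])
  ultimately show ?thesis unfolding pullback_def by blast
qed

definition rational_map ::
  "('k::field, 'n::finite) pspace set \<Rightarrow> (('k, 'n) pspace \<Rightarrow> ('k, 'm::finite) pspace) \<Rightarrow> bool" where
  "rational_map X \<phi> \<longleftrightarrow> (\<exists>d (F :: 'm \<Rightarrow> ('k, 'n) mpoly). (\<forall>j. homogeneous d (F j)) \<and>
     eventually (\<lambda>Q. \<exists>c. c \<noteq> 0 \<and> rep_pspace (\<phi> Q) = c *s (\<chi> j. mp_eval (F j) (rep_pspace Q))) (generic X))"

lemma morphism_imp_rational_map:
  assumes X: "irreducible_set X" and "zariski_open V" "V \<inter> X \<noteq> {}" "morphism_on (V \<inter> X) \<phi>"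
  shows "rational_map X \<phi>"
proof -
  from assms obtain P where P: "P \<in> V \<inter> X" by auto
  obtain U d F where U: "zariski_open U" "P \<in> U" "\<And>j. homogeneous d (F j)"
    "\<And>Q. Q \<in> U \<Longrightarrow> Q \<in> V \<inter> X \<Longrightarrow>
       \<exists>c. c \<noteq> 0 \<and> rep_pspace (\<phi> Q) = c *s (\<chi> j. mp_eval (F j) (rep_pspace Q))"
    using morphism_on_local[OF assms(4) P] by blast
  have "eventually (\<lambda>Q. Q \<in> U \<inter> V) (generic X)"
    by (rule eventually_generic_open) (use X U(1,2) P assms zariski_open_Int in auto)
  then have "eventually (\<lambda>Q. \<exists>c. c \<noteq> 0 \<and> rep_pspace (\<phi> Q) = c *s (\<chi> j. mp_eval (F j) (rep_pspace Q))) (generic X)"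
    using eventually_generic_in[OF X] by eventually_elim (rule U(4), auto)
  then show ?thesis unfolding rational_map_def using U(3) by blast
qed

lemma rational_function_comp:
  assumes lim: "filterlim \<phi> (generic Y) (generic X)"
    and "rational_map X \<phi>" "rational_function Y f"
  shows "rational_function X (f \<circ> \<phi>)"
proof -
  from assms(2) obtain e H where H: "\<And>j. homogeneous e (H j)"
    "eventually (\<lambda>Q. \<exists>c. c \<noteq> 0 \<and> rep_pspace (\<phi> Q) = c *s (\<chi> j. mp_eval (H j) (rep_pspace Q))) (generic X)"
    unfolding rational_map_def by blast
  from assms(3) obtain d F G where F: "homogeneous d F" "homogeneous d G"
     "eventually (\<lambda>Q. mp_eval G (rep_pspace Q) \<noteq> 0 \<and>
       f Q = mp_eval F (rep_pspace Q) / mp_eval G (rep_pspace Q)) (generic Y)"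
    unfolding rational_function_def by blast
  have "eventually (\<lambda>Q. mp_eval G (rep_pspace (\<phi> Q)) \<noteq> 0 \<and>
       f (\<phi> Q) = mp_eval F (rep_pspace (\<phi> Q)) / mp_eval G (rep_pspace (\<phi> Q))) (generic X)"
    by (rule eventually_compose_filterlim[OF F(3) lim])
  with H(2) have "eventually (\<lambda>Q. mp_eval (mp_subst H G) (rep_pspace Q) \<noteq> 0 \<and>
       (f \<circ> \<phi>) Q = mp_eval (mp_subst H F) (rep_pspace Q) / mp_eval (mp_subst H G) (rep_pspace Q)) (generic X)"
    by eventually_elim (auto simp: mp_eval_subst mp_eval_scale[OF F(1)] mp_eval_scale[OF F(2)])
  then show ?thesis
    unfolding rational_function_def
    by (intro exI conjI) (rule homogeneous_subst[OF F(1) H(1)], rule homogeneous_subst[OF F(2) H(1)])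
qed

lemma germ_comp_mem_function_field:
  assumes "irreducible_set X" "irreducible_set Y" "filterlim \<phi> (generic Y) (generic X)" "rational_map X \<phi>"
    and "b \<in> carrier (function_field Y)"
  shows "pullback X \<phi> b \<in> carrier (function_field X)"
proof -
  from assms(5) obtain f where f: "b = germ Y f" "rational_function Y f"
    unfolding carrier_function_field[OF assms(2)] by blast
  then have "pullback X \<phi> b = germ X (f \<circ> \<phi>)" by (simp add: pullback_germ[OF assms(1-3)])
  moreover have "rational_function X (f \<circ> \<phi>)" by (rule rational_function_comp[OF assms(3,4) f(2)])
  ultimately show ?thesis unfolding carrier_function_field[OF assms(1)] by blast
qed

text \<open>Pullback along the inverse \<psi> is the inverse map. The main point is that \<psi>, a
  morphism only on an open part of the image, is dominant too.\<close>

lemma birational_embedding_bij_betw: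
  assumes X: "irreducible_set X" and emb: "birational_embedding X \<phi>"
  shows "bij_betw (pullback X \<phi>) (carrier (function_field (\<phi> ` X))) (carrier (function_field X))"
proof -
  from emb obtain V \<psi> where mor: "morphism_on X \<phi>" and V: "zariski_open V" "V \<inter> \<phi> ` X \<noteq> {}"
    "morphism_on (V \<inter> \<phi> ` X) \<psi>" "\<And>Q. Q \<in> V \<inter> \<phi> ` X \<Longrightarrow> \<psi> Q \<in> X \<and> \<phi> (\<psi> Q) = Q"
    "\<And>P. P \<in> X \<Longrightarrow> \<phi> P \<in> V \<Longrightarrow> \<psi> (\<phi> P) = P"
    unfolding birational_embedding_def by blast
  let ?C = "\<phi> ` X"
  note C = irreducible_image[OF X mor]
  note lim = filterlim_generic_image[OF X mor]
  have rat: "rational_map X \<phi>"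
    using morphism_imp_rational_map[OF X zariski_open_UNIV] mor X by (auto simp: irreducible_set_def)
  have rat': "rational_map ?C \<psi>"
    by (rule morphism_imp_rational_map[OF C V(1-3)])
  have VC: "eventually (\<lambda>Q. Q \<in> V \<inter> ?C) (generic ?C)"
    using eventually_generic_open[OF C V(1,2)] eventually_generic_in[OF C] by eventually_elim auto
  have lim': "filterlim \<psi> (generic X) (generic ?C)"
    unfolding filterlim_iff eventually_generic[OF X]
  proof (intro allI impI, elim exE conjE)
    fix P U assume U: "zariski_open U" "U \<inter> X \<noteq> {}" "\<forall>Q\<in>U \<inter> X. P Q"
    have "eventually (\<lambda>Q. \<phi> Q \<in> V) (generic X)"
      by (rule eventually_vimage[OF X mor V(1,2)])
    moreover have "eventually (\<lambda>Q. Q \<in> U) (generic X)" by (rule eventually_generic_open[OF X U(1,2)])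
    ultimately have "eventually (\<lambda>Q. \<phi> Q \<in> V \<and> Q \<in> U \<and> Q \<in> X) (generic X)"
      using eventually_generic_in[OF X] by eventually_elim auto
    \<comment> \<open>Since \<open>\<psi> (\<phi> P0) = P0\<close>, the point
      \<open>\<phi> P0\<close> shows that the preimage of \<open>U\<close> under \<psi> is
      nonempty.\<close>
    then obtain P0 where P0: "P0 \<in> X" "P0 \<in> U" "\<phi> P0 \<in> V"
      using generic_nontrivial[OF X] eventually_happens' by blast
    have "rel_open (V \<inter> ?C) {Q \<in> V \<inter> ?C. \<psi> Q \<in> U}" by (rule rel_open_vimage[OF V(3) U(1)])
    moreover have "\<phi> P0 \<in> {Q \<in> V \<inter> ?C. \<psi> Q \<in> U}" using P0 V(5) by simp
    ultimately obtain W where W: "zariski_open W" "\<phi> P0 \<in> W" "W \<inter> (V \<inter> ?C) \<subseteq> {Q \<in> V \<inter> ?C. \<psi> Q \<in> U}"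
      unfolding rel_open_def by blast
    have "W \<inter> ?C \<noteq> {}" using W(2) P0(1) by auto
    from eventually_generic_open[OF C W(1) this] VC
    show "eventually (\<lambda>Q. P (\<psi> Q)) (generic ?C)"
      by eventually_elim (use W(3) U(3) V(4) in blast)
  qed
  have \<psi>\<phi>: "eventually (\<lambda>P. \<psi> (\<phi> P) = P) (generic X)"
    using eventually_vimage[OF X mor V(1,2)] eventually_generic_in[OF X] by eventually_elim (use V(5) in auto)
  have \<phi>\<psi>: "eventually (\<lambda>Q. \<phi> (\<psi> Q) = Q) (generic ?C)"
    using VC by eventually_elim (use V(4) in auto)
  show ?thesis
  proof (rule bij_betwI[where g = "pullback ?C \<psi>"])
    show "pullback X \<phi> \<in> carrier (function_field ?C) \<rightarrow> carrier (function_field X)"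
      using germ_comp_mem_function_field[OF X C lim rat] by blast
    show "pullback ?C \<psi> \<in> carrier (function_field X) \<rightarrow> carrier (function_field ?C)"
      using germ_comp_mem_function_field[OF C X lim' rat'] by blast
    fix a assume "a \<in> carrier (function_field ?C)"
    then obtain f where f: "a = germ ?C f" by (auto simp: carrier_function_field[OF C])
    have "eventually (\<lambda>Q. f (\<phi> (\<psi> Q)) = f Q) (generic ?C)" using \<phi>\<psi> by eventually_elim simp
    then show "pullback ?C \<psi> (pullback X \<phi> a) = a"
      by (simp add: f pullback_germ[OF X C lim] pullback_germ[OF C X lim'] germ_eq_iff[OF C])
  next
    fix b assume "b \<in> carrier (function_field X)"
    then obtain f where f: "b = germ X f" by (auto simp: carrier_function_field[OF X])
    have "eventually (\<lambda>Q. f (\<psi> (\<phi> Q)) = f Q) (generic X)" using \<psi>\<phi> by eventually_elim simp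
    then show "pullback X \<phi> (pullback ?C \<psi> b) = b"
      by (simp add: f pullback_germ[OF X C lim] pullback_germ[OF C X lim'] germ_eq_iff[OF X])
  qed
qed

text \<open>The Galois condition makes the projected field the fixed field of a group that consists
  of the actions of \<open>G\<close>; pullback along \<phi> translates being fixed by such an action
  into being fixed by \<sigma>. The right-hand side mentions neither \<phi> nor \<open>R\<close>,
  which is what allows two embeddings to be compared.\<close>

lemma pullback_projected_field:
  assumes X: "irreducible_set X" and emb: "birational_embedding X \<phi>"
    and gal: "galois_point (\<phi> ` X) R" and grp: "is_galois_group_at X \<phi> R G"
    and G: "G \<subseteq> carrier (aut_group X)"
  shows "pullback X \<phi> ` projected_field (\<phi> ` X) R =
    {b \<in> carrier (function_field X). \<forall>\<sigma>\<in>G. pullback X \<sigma> b = b}"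
proof -
  let ?K = "function_field (\<phi> ` X)"
  note bij = birational_embedding_bij_betw[OF X emb]
  \<comment> \<open>Needed for \<open>inv_into\<close> in \<open>function_field_action\<close> to
    return a true preimage and not an arbitrary value.\<close>
  have stable: "pullback X \<sigma> b \<in> carrier (function_field X)"
    if \<sigma>: "\<sigma> \<in> G" and b: "b \<in> carrier (function_field X)" for \<sigma> b
  proof -
    from \<sigma> G have "\<sigma> \<in> carrier (aut_group X)" by blast
    then have mor: "morphism_on X \<sigma>" and "\<sigma> \<in> Bij X"
      by (simp_all add: aut_group_def)
    then have im: "\<sigma> ` X = X" by (simp add: Bij_def bij_betw_def)
    have "rational_map X \<sigma>"
      using morphism_imp_rational_map[OF X zariski_open_UNIV] mor X by (auto simp: irreducible_set_def)
    then show ?thesis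
      using germ_comp_mem_function_field[OF X X, of \<sigma> b] filterlim_generic_image[OF X mor] b im by simp
  qed
  have act: "function_field_action X \<phi> \<sigma> a = a \<longleftrightarrow> pullback X \<sigma> (pullback X \<phi> a) = pullback X \<phi> a"
    if "\<sigma> \<in> G" "a \<in> carrier ?K" for \<sigma> a
  proof -
    have "pullback X \<phi> a \<in> carrier (function_field X)" using bij that(2) by (auto simp: bij_betw_def)
    then have "pullback X \<sigma> (pullback X \<phi> a) \<in> pullback X \<phi> ` carrier ?K"
      using stable[OF that(1)] bij by (simp add: bij_betw_def)
    then obtain a' where a': "a' \<in> carrier ?K" "pullback X \<sigma> (pullback X \<phi> a) = pullback X \<phi> a'" by blast
    then have "function_field_action X \<phi> \<sigma> a = a'"
      using that(2) bij_betw_imp_inj_on[OF bij] by (simp add: function_field_action_def)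
    then show ?thesis
      using a' that(2) bij_betw_imp_inj_on[OF bij] by (auto dest: inj_onD)
  qed
  have "projected_field (\<phi> ` X) R =
      {a \<in> carrier ?K. \<forall>\<tau>\<in>galois_group ?K (projected_field (\<phi> ` X) R). \<tau> a = a}"
    using gal unfolding galois_point_def galois_extension_def by blast
  also have "\<dots> = {a \<in> carrier ?K. \<forall>\<sigma>\<in>G. function_field_action X \<phi> \<sigma> a = a}"
    unfolding grp[unfolded is_galois_group_at_def, symmetric] by simp
  also have "\<dots> = {a \<in> carrier ?K. \<forall>\<sigma>\<in>G. pullback X \<sigma> (pullback X \<phi> a) = pullback X \<phi> a}"
    using act by blast
  finally have "pullback X \<phi> ` projected_field (\<phi> ` X) R =
      {b \<in> pullback X \<phi> ` carrier ?K. \<forall>\<sigma>\<in>G. pullback X \<sigma> b = b}" by auto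
  then show ?thesis using bij by (simp add: bij_betw_def)
qed

section \<open>Projection from a point of the plane\<close>

lemma ex_not_in_span:
  fixes B :: "('k::field ^ 3) set"
  assumes "finite B" "card B < 3"
  obtains e where "e \<notin> vec.span B"
proof -
  have "vec.span B \<noteq> UNIV"
  proof
    assume "vec.span B = UNIV"
    then have "vec.dim (UNIV :: ('k ^ 3) set) \<le> card B"
      using assms(1) vec.dim_le_card[of UNIV B] by simp
    then show False using assms(2) by (simp add: card_cart_basis)
  qed
  then show ?thesis using that by blast
qed

lemma ex_frame:
  fixes r1 r2 :: "'k::field ^ 3"
  assumes "r1 \<noteq> 0" "r2 \<notin> vec.span {r1}"
  obtains S :: "'k ^ 3 ^ 3" where "invertible S" "S *v r1 = axis 1 1" "S *v r2 = axis 2 1"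
proof -
  have "card {r1, r2} < 3" by (simp add: card_insert_if)
  then obtain e where e: "e \<notin> vec.span {r1, r2}"
    using ex_not_in_span[of "{r1, r2}"] by auto
  \<comment> \<open>The columns of \<open>M\<close> are the basis \<open>r1\<close>,
    \<open>r2\<close>, \<open>e\<close>; the frame \<open>S\<close> is its inverse.\<close>
  define M :: "'k ^ 3 ^ 3" where "M = (\<chi> i j. if j = 1 then r1 $ i else if j = 2 then r2 $ i else e $ i)"
  have M: "M *v x = x $ 1 *s r1 + x $ 2 *s r2 + x $ 3 *s e" for x
    by (simp add: M_def matrix_vector_mult_def vec_eq_iff sum_3 algebra_simps)
  have "x = 0" if "M *v x = 0" for x
  proof -
    have "x $ 3 *s e = (- x $ 1) *s r1 + (- x $ 2) *s r2"
      using that unfolding M by (simp add: vec_eq_iff add_eq_0_iff)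
    also have "\<dots> \<in> vec.span {r1, r2}"
      by (intro vec.span_add vec.span_scale vec.span_base) auto
    finally have x3: "x $ 3 = 0"
      using e vec.span_scale[of "x $ 3 *s e" "{r1, r2}" "1 / x $ 3"] by (auto simp: vector_smult_assoc split: if_splits)
    then have "x $ 2 *s r2 = (- x $ 1) *s r1"
      using that unfolding M by (simp add: vec_eq_iff add_eq_0_iff)
    also have "\<dots> \<in> vec.span {r1}" by (intro vec.span_scale vec.span_base) auto
    finally have x2: "x $ 2 = 0"
      using assms(2) vec.span_scale[of "x $ 2 *s r2" "{r1}" "1 / x $ 2"] by (auto simp: vector_smult_assoc split: if_splits)
    then have "x $ 1 *s r1 = 0" using that x3 unfolding M by simp
    then have "x $ 1 = 0" using assms(1) by (simp add: vector_mul_eq_0)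
    with x2 x3 show ?thesis by (simp add: vec_eq_iff forall_3)
  qed
  then obtain S where S: "S ** M = mat 1" using matrix_left_invertible_ker[of M] by blast
  then have "invertible S"
    using matrix_left_right_inverse[of S M] unfolding invertible_def by blast
  moreover have "M *v axis 1 1 = r1" "M *v axis 2 1 = r2"
    unfolding M by (simp_all add: axis_def)
  then have "S *v r1 = axis 1 1" "S *v r2 = axis 2 1"
    using S by (metis matrix_vector_mul_assoc matrix_vector_mul_lid)+
  ultimately show ?thesis by (rule that)
qed

lemma rep_pspace_in_span_iff: "rep_pspace P \<in> vec.span {rep_pspace R} \<longleftrightarrow> P = R"
proof
  assume "rep_pspace P \<in> vec.span {rep_pspace R}"
  then obtain c where c: "rep_pspace P = c *s rep_pspace R" by (auto simp: vec.span_singleton)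
  then have "c \<noteq> 0" using rep_pspace_nonzero[of P] by (auto simp del: rep_pspace_nonzero)
  then have "abs_pspace (rep_pspace P) = abs_pspace (rep_pspace R)" unfolding c by simp
  then show "P = R" by simp
qed (auto intro: vec.span_base)

text \<open>Since \<open>projection_matrix\<close> is a choice, a suitable matrix has to be
  exhibited: rows 2 and 3 of a coordinate change that moves the point to (1:0:0).\<close>

lemma projection_matrix_kernel:
  "projection_matrix R *v v = 0 \<longleftrightarrow> v \<in> vec.span {rep_pspace R}"
proof -
  let ?r = "rep_pspace R"
  obtain r2 where "r2 \<notin> vec.span {?r}" using ex_not_in_span[of "{?r}"] by auto
  then obtain S :: "'a ^ 3 ^ 3" where S: "invertible S" "S *v ?r = axis 1 1"
    using ex_frame[of ?r r2] by (metis rep_pspace_nonzero)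
  define A :: "'a ^ 3 ^ 2" where "A = (\<chi> i. if i = 1 then S $ 2 else S $ 3)"
  from S(1) obtain T where T: "T ** S = mat 1" by (auto simp: invertible_def)
  have "A *v v = 0 \<longleftrightarrow> v \<in> vec.span {?r}" for v
  proof
    assume "A *v v = 0"
    then have "(A *v v) $ 1 = 0" "(A *v v) $ 2 = 0" by simp_all
    then have "(S *v v) $ 2 = 0" "(S *v v) $ 3 = 0"
      by (simp_all add: A_def matrix_vector_mult_nth_dot)
    then have "S *v v = S *v ((S *v v) $ 1 *s ?r)"
      by (simp add: S(2) vector_scalar_commute vec_eq_iff forall_3 axis_def)
    then have "v = (S *v v) $ 1 *s ?r"
      using T by (metis matrix_vector_mul_assoc matrix_vector_mul_lid)
    then show "v \<in> vec.span {?r}" by (metis insertI1 vec.span_base vec.span_scale)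
  next
    assume "v \<in> vec.span {?r}"
    then obtain c where c: "v = c *s ?r" by (auto simp: vec.span_singleton)
    have "(S *v v) $ 2 = 0" "(S *v v) $ 3 = 0"
      by (simp_all add: c S(2) vector_scalar_commute axis_def)
    then show "A *v v = 0"
      by (simp add: vec_eq_iff forall_2 A_def matrix_vector_mult_nth_dot)
  qed
  then have "\<exists>A :: 'a ^ 3 ^ 2. {v. A *v v = 0} = vec.span {?r}" by blast
  then have "{v. projection_matrix R *v v = 0} = vec.span {?r}"
    unfolding projection_matrix_def by (rule someI_ex)
  then show ?thesis by blast
qed

text \<open>The indices remain variables because the results below are used with
  \<open>(i, j, l)\<close> equal to (1, 2, 3) for one Galois point and (2, 1, 3) for the
  other.\<close>

lemma sum_distinct_3:
  fixes i j l :: 3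
  assumes "i \<noteq> j" "i \<noteq> l" "j \<noteq> l"
  shows "sum f UNIV = f i + (f j + f l)"
proof -
  have "{i, j, l} = UNIV"
    using assms by (intro card_subset_eq) auto
  moreover have "sum f {i, j, l} = f i + (f j + f l)" using assms by simp
  ultimately show ?thesis by simp
qed

text \<open>The matrix kills the \<open>i\<close>-th basis vector of the frame, so \<open>p\<close>
  and \<open>q\<close> are the images of the other two. They are independent because the kernel is
  no larger than the line of \<open>R\<close>.\<close>

lemma projection_matrix_coordinates:
  fixes S :: "'k::field ^ 3 ^ 3" and i j l :: 3
  assumes S: "invertible S" "S *v rep_pspace R = axis i 1"
    and ijl: "i \<noteq> j" "i \<noteq> l" "j \<noteq> l"
  obtains p q :: "'k ^ 2" where
    "\<And>v. projection_matrix R *v v = (S *v v) $ j *s p + (S *v v) $ l *s q"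
    "p $ 1 * q $ 2 - p $ 2 * q $ 1 \<noteq> 0"
proof -
  let ?A = "projection_matrix R"
  from S(1) obtain T where T: "T ** S = mat 1" "S ** T = mat 1" by (auto simp: invertible_def)
  then have TS: "T *v (S *v v) = v" "S *v (T *v v) = v" for v
    by (metis matrix_vector_mul_assoc matrix_vector_mul_lid)+
  define p where "p = ?A *v (T *v axis j 1)"
  define q where "q = ?A *v (T *v axis l 1)"
  have expand: "?A *v v = (S *v v) $ j *s p + (S *v v) $ l *s q" for v
  proof -
    have "S *v v = (\<Sum>m\<in>UNIV. (S *v v) $ m *s axis m 1)"
      by (simp add: basis_expansion)
    also have "\<dots> = (S *v v) $ i *s axis i 1 + ((S *v v) $ j *s axis j 1 + (S *v v) $ l *s axis l 1)"
      by (rule sum_distinct_3[OF ijl])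
    finally have "T *v (S *v v) = T *v \<dots>" by (rule arg_cong)
    then have "v = (S *v v) $ i *s (T *v axis i 1) +
        ((S *v v) $ j *s (T *v axis j 1) + (S *v v) $ l *s (T *v axis l 1))"
      by (simp only: matrix_vector_right_distrib vector_scalar_commute TS)
    also have "T *v axis i 1 = rep_pspace R" using TS(1)[of "rep_pspace R"] S(2) by simp
    finally have "?A *v v = ?A *v ((S *v v) $ i *s rep_pspace R +
        ((S *v v) $ j *s (T *v axis j 1) + (S *v v) $ l *s (T *v axis l 1)))"
      by (rule arg_cong)
    then have "?A *v v = (S *v v) $ i *s (?A *v rep_pspace R) + ((S *v v) $ j *s p + (S *v v) $ l *s q)"
      by (simp only: p_def q_def matrix_vector_right_distrib vector_scalar_commute)
    moreover have "?A *v rep_pspace R = 0"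
      by (simp add: projection_matrix_kernel vec.span_base)
    ultimately show ?thesis by simp
  qed
  have indep: "\<alpha> = 0 \<and> \<beta> = 0" if "\<alpha> *s p + \<beta> *s q = 0" for \<alpha> \<beta>
  proof -
    define v where "v = T *v (\<alpha> *s axis j 1 + \<beta> *s axis l 1)"
    have Sv: "S *v v = \<alpha> *s axis j 1 + \<beta> *s axis l 1" by (simp add: v_def TS)
    then have "?A *v v = 0" using that ijl unfolding expand by (simp add: axis_def)
    then obtain c where "v = c *s rep_pspace R"
      unfolding projection_matrix_kernel by (auto simp: vec.span_singleton)
    then have "S *v v = c *s axis i 1" by (simp add: S(2) vector_scalar_commute)
    then have "(\<alpha> *s axis j 1 + \<beta> *s axis l 1) $ j = (c *s axis i (1 :: 'k)) $ j"
      "(\<alpha> *s axis j 1 + \<beta> *s axis l 1) $ l = (c *s axis i (1 :: 'k)) $ l" unfolding Sv by simp_all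
    then show ?thesis using ijl by (simp add: axis_def)
  qed
  have "p $ 1 * q $ 2 - p $ 2 * q $ 1 \<noteq> 0"
  proof
    assume det: "p $ 1 * q $ 2 - p $ 2 * q $ 1 = 0"
    then have "q $ 2 *s p + (- p $ 2) *s q = 0" "q $ 1 *s p + (- p $ 1) *s q = 0"
      by (simp_all add: vec_eq_iff forall_2 algebra_simps)
    then have "p = 0" using indep[of "q $ 2" "- p $ 2"] indep[of "q $ 1" "- p $ 1"] by (simp add: vec_eq_iff forall_2)
    then show False using indep[of 1 0] by simp
  qed
  with expand show ?thesis by (rule that)
qed

text \<open>Where the \<open>l\<close>-th coordinate vanishes this is 0 by the convention for
  division; only its generic values are used.\<close>

definition affine_coord :: "'k::field ^ 3 ^ 3 \<Rightarrow> 3 \<Rightarrow> 3 \<Rightarrow> ('k, 3) pspace \<Rightarrow> 'k" where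
  "affine_coord S j l Q = (S *v rep_pspace Q) $ j / (S *v rep_pspace Q) $ l"

text \<open>Relative to the basis \<open>p\<close>, \<open>q\<close> of the target, the projection
  is the map to (x : 1) with \<open>x\<close> the affine coordinate. This links the arbitrarily
  chosen matrix to a concrete function.\<close>

lemma projection_affine_coord:
  fixes S :: "'k::field ^ 3 ^ 3" and i j l :: 3
  assumes "invertible S" "S *v rep_pspace R = axis i 1" "i \<noteq> j" "i \<noteq> l" "j \<noteq> l"
  obtains p q :: "'k ^ 2" where "p $ 1 * q $ 2 - p $ 2 * q $ 1 \<noteq> 0"
    "\<And>Q. (S *v rep_pspace Q) $ l \<noteq> 0 \<Longrightarrow>
       \<exists>c. c \<noteq> 0 \<and> rep_pspace (projection R Q) = c *s (affine_coord S j l Q *s p + q)"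
proof -
  obtain p q :: "'k ^ 2" where pq: "\<And>v. projection_matrix R *v v = (S *v v) $ j *s p + (S *v v) $ l *s q"
    and det: "p $ 1 * q $ 2 - p $ 2 * q $ 1 \<noteq> 0"
    using projection_matrix_coordinates[OF assms] by blast
  have "\<exists>c. c \<noteq> 0 \<and> rep_pspace (projection R Q) = c *s (affine_coord S j l Q *s p + q)"
    if l: "(S *v rep_pspace Q) $ l \<noteq> 0" for Q
  proof -
    let ?x = "affine_coord S j l Q" and ?c = "(S *v rep_pspace Q) $ l"
    have eq: "projection_matrix R *v rep_pspace Q = ?c *s (?x *s p + q)"
      using l by (simp add: pq affine_coord_def vec_eq_iff algebra_simps)
    have "?x *s p + q \<noteq> 0"
    proof
      assume "?x *s p + q = 0"
      then have "q $ 1 = - ?x * p $ 1" "q $ 2 = - ?x * p $ 2"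
        by (simp_all add: vec_eq_iff forall_2 add_eq_0_iff)
      then show False using det by (simp add: algebra_simps)
    qed
    then obtain c where "c \<noteq> 0" "rep_pspace (abs_pspace (?x *s p + q)) = c *s (?x *s p + q)"
      by (rule rep_abs_pspace)
    moreover have "projection R Q = abs_pspace (?x *s p + q)"
      unfolding projection_def eq using l \<open>?x *s p + q \<noteq> 0\<close> by (rule abs_pspace_smult)
    ultimately show ?thesis by auto
  qed
  with det show ?thesis by (rule that)
qed

lemma row_combination_nonzero:
  fixes S :: "'k::field ^ 'n ^ 'n"
  assumes "invertible S" "j \<noteq> l"
  shows "S $ j + c *s S $ l \<noteq> 0"
proof
  assume *: "S $ j + c *s S $ l = 0"
  from assms(1) obtain T where T: "S ** T = mat 1" by (auto simp: invertible_def)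
  then have "S *v (T *v axis j 1) = axis j 1" by (metis matrix_vector_mul_assoc matrix_vector_mul_lid)
  then have "dot (S $ j + c *s S $ l) (T *v axis j 1) = 1"
    using assms(2) by (simp add: dot_add_left dot_smult_left axis_def flip: matrix_vector_mult_nth_dot)
  then show False by (simp add: * dot_def)
qed

locale nonlinear_curve =
  fixes C :: "('k::alg_closed_field, 3) pspace set" and d :: nat
  assumes irreducible: "irreducible_set C" and degree: "has_plane_degree C d" "d \<ge> 2"
begin

lemma eventually_coord_nonzero:
  fixes S :: "'k ^ 3 ^ 3"
  assumes "invertible S" "j \<noteq> l"
  shows "eventually (\<lambda>Q. (S *v rep_pspace Q) $ j + c * (S *v rep_pspace Q) $ l \<noteq> 0) (generic C)"
  using eventually_not_in_line[OF irreducible degree row_combination_nonzero[OF assms, of c]]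
  by (simp add: dot_add_left dot_smult_left matrix_vector_mult_nth_dot)

lemma eventually_denominator_nonzero:
  fixes S :: "'k ^ 3 ^ 3"
  assumes "invertible S" "j \<noteq> l"
  shows "eventually (\<lambda>Q. (S *v rep_pspace Q) $ l \<noteq> 0) (generic C)"
  using eventually_coord_nonzero[OF assms(1) assms(2)[symmetric], of 0] by simp

lemma eventually_affine_coord_neq:
  fixes S :: "'k ^ 3 ^ 3"
  assumes "invertible S" "j \<noteq> l"
  shows "eventually (\<lambda>Q. affine_coord S j l Q \<noteq> c) (generic C)"
  using eventually_coord_nonzero[OF assms, of "- c"] eventually_denominator_nonzero[OF assms]
  by eventually_elim (auto simp: affine_coord_def)

text \<open>Generically the coordinate avoids each of the finitely many roots of \<open>p\<close>.
  In field terms it is transcendental over the constants.\<close>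

lemma eventually_poly_affine_coord:
  fixes S :: "'k ^ 3 ^ 3"
  assumes "invertible S" "j \<noteq> l" "p \<noteq> 0"
  shows "eventually (\<lambda>Q. poly p (affine_coord S j l Q) \<noteq> 0) (generic C)"
proof -
  have "eventually (\<lambda>Q. \<forall>c\<in>{x. poly p x = 0}. affine_coord S j l Q \<noteq> c) (generic C)"
    using assms(3) eventually_affine_coord_neq[OF assms(1,2)]
    by (subst eventually_ball_finite_distrib) (auto simp: poly_roots_finite)
  then show ?thesis by eventually_elim blast
qed

context
  fixes R :: "('k, 3) pspace" and S :: "'k ^ 3 ^ 3" and i j l :: 3
  assumes frame: "invertible S" "S *v rep_pspace R = axis i 1" "i \<noteq> j" "i \<noteq> l" "j \<noteq> l"
begin

text \<open>Dominance of the projection: a form that is nonzero somewhere on the projective line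
  becomes a nonzero polynomial in the affine coordinate.\<close>

lemma eventually_projection_in_open:
  assumes "zariski_open U" "U \<noteq> {}"
  shows "eventually (\<lambda>Q. projection R Q \<in> U) (generic C)"
proof -
  obtain p q :: "'k ^ 2" where det: "p $ 1 * q $ 2 - p $ 2 * q $ 1 \<noteq> 0"
    and proj: "\<And>Q. (S *v rep_pspace Q) $ l \<noteq> 0 \<Longrightarrow>
       \<exists>c. c \<noteq> 0 \<and> rep_pspace (projection R Q) = c *s (affine_coord S j l Q *s p + q)"
    using projection_affine_coord[OF frame] by blast
  from assms(1) obtain T where T: "\<forall>F\<in>T. \<exists>e. homogeneous e F"
    "U = {P. \<exists>F\<in>T. mp_eval F (rep_pspace P) \<noteq> 0}"
    unfolding zariski_open_iff by blast
  then obtain P0 H e where H: "H \<in> T" "homogeneous e H" "mp_eval H (rep_pspace P0) \<noteq> 0"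
    using assms(2) by blast
  define r where "r = mp_to_poly (\<lambda>i. [:q $ i, p $ i:]) H"
  have r: "poly r x = mp_eval H (x *s p + q)" for x
  proof -
    have "(\<chi> i. poly [:q $ i, p $ i:] x) = x *s p + q" by (simp add: vec_eq_iff)
    then show ?thesis by (simp add: r_def poly_mp_to_poly)
  qed
  have "r \<noteq> 0"
  proof
    assume "r = 0"
    then have zero: "mp_eval H (x *s p + q) = 0" for x using r by (metis poly_0)
    let ?D = "p $ 1 * q $ 2 - p $ 2 * q $ 1" and ?v = "rep_pspace P0"
    \<comment> \<open>The coordinates of the representative of \<open>P0\<close> in the basis
      \<open>p\<close>, \<open>q\<close>, by Cramer's rule.\<close>
    define x where "x = (?v $ 1 * q $ 2 - ?v $ 2 * q $ 1) / ?D"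
    define y where "y = (p $ 1 * ?v $ 2 - p $ 2 * ?v $ 1) / ?D"
    have v: "?v = x *s p + y *s q"
      using det unfolding x_def y_def by (simp add: vec_eq_iff forall_2 divide_simps) (simp add: algebra_simps)
    show False
    proof (cases "y = 0")
      case False
      then have "?v = y *s ((x / y) *s p + q)" unfolding v by (simp add: vec_eq_iff algebra_simps)
      then show False using H zero mp_eval_scale[OF H(2)] by (metis mult_zero_right)
    next
      case True
      \<comment> \<open>For \<open>y = 0\<close> the point is the one that \<open>x *s p + q\<close>
        never reaches. Vanishing at \<open>p\<close> follows from vanishing at
        \<open>p + t *s q\<close> for all \<open>t \<noteq> 0\<close>.\<close>
      define r' where "r' = mp_to_poly (\<lambda>i. [:p $ i, q $ i:]) H"
      have r': "poly r' t = mp_eval H (p + t *s q)" for t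
      proof -
        have "(\<chi> i. poly [:p $ i, q $ i:] t) = p + t *s q" by (simp add: vec_eq_iff)
        then show ?thesis by (simp add: r'_def poly_mp_to_poly)
      qed
      have "poly r' t = 0" if "t \<noteq> 0" for t
      proof -
        have "p + t *s q = t *s ((1 / t) *s p + q)" using that by (simp add: vec_eq_iff algebra_simps)
        then show ?thesis unfolding r' using mp_eval_scale[OF H(2)] zero by (metis mult_zero_right)
      qed
      then have "r' = 0"
        by (intro poly_eq_0_finite_exceptions[OF infinite_UNIV_alg_closed, of "{0}"]) auto
      then have "mp_eval H p = 0" using r'[of 0] by simp
      then show False using H(3) True unfolding v by (simp add: mp_eval_scale[OF H(2)])
    qed
  qed
  from eventually_poly_affine_coord[OF frame(1,5) this] eventually_denominator_nonzero[OF frame(1,5)]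
  show ?thesis
  proof eventually_elim
    case (elim Q)
    then obtain c where c: "c \<noteq> 0" "rep_pspace (projection R Q) = c *s (affine_coord S j l Q *s p + q)"
      using proj by blast
    have "mp_eval H (rep_pspace (projection R Q)) \<noteq> 0"
      unfolding c(2) using elim(1) c(1) by (simp add: mp_eval_scale[OF H(2)] r)
    then show ?case using T(2) H(1) by blast
  qed
qed

text \<open>Argues from the definition of \<open>germ UNIV\<close>, which spares a proof that the
  projective line is irreducible.\<close>

lemma pullback_projection_germ:
  "pullback C (projection R) (germ UNIV f) = germ C (f \<circ> projection R)"
proof -
  have "germ C (g \<circ> projection R) = germ C (f \<circ> projection R)" if "g \<in> germ UNIV f" for g
  proof -
    from that obtain U where U: "zariski_open U" "U \<noteq> {}" "\<forall>Q\<in>U. g Q = f Q" by (auto simp: germ_def)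
    from eventually_projection_in_open[OF U(1,2)] show ?thesis
      unfolding germ_eq_iff[OF irreducible] by eventually_elim (use U(3) in simp)
  qed
  moreover have "f \<in> germ UNIV f" using zariski_open_UNIV by (auto simp: germ_def)
  ultimately show ?thesis unfolding pullback_def by blast
qed

lemma affine_coord_mem_projected_field:
  "germ C (affine_coord S j l) \<in> projected_field C R"
proof -
  obtain p q :: "'k ^ 2" where det: "p $ 1 * q $ 2 - p $ 2 * q $ 1 \<noteq> 0"
    and proj: "\<And>Q. (S *v rep_pspace Q) $ l \<noteq> 0 \<Longrightarrow>
       \<exists>c. c \<noteq> 0 \<and> rep_pspace (projection R Q) = c *s (affine_coord S j l Q *s p + q)"
    using projection_affine_coord[OF frame] by blast
  let ?D = "p $ 1 * q $ 2 - p $ 2 * q $ 1"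
  \<comment> \<open>The linear forms \<alpha> and \<beta> are the dual basis of \<open>p\<close>,
    \<open>q\<close>; their quotient on the projective line pulls back to the affine
    coordinate.\<close>
  define \<alpha> :: "'k ^ 2" where "\<alpha> = (1 / ?D) *s vector [q $ 2, - q $ 1]"
  define \<beta> :: "'k ^ 2" where "\<beta> = (1 / ?D) *s vector [- p $ 2, p $ 1]"
  have dual: "dot \<alpha> p = 1" "dot \<alpha> q = 0" "dot \<beta> p = 0" "dot \<beta> q = 1"
  proof -
    have "dot \<alpha> p = ?D / ?D" "dot \<alpha> q = 0" "dot \<beta> p = 0" "dot \<beta> q = ?D / ?D"
      unfolding \<alpha>_def \<beta>_def dot_smult_left by (simp_all add: dot_def sum_2 mult.commute)
    then show "dot \<alpha> p = 1" "dot \<alpha> q = 0" "dot \<beta> p = 0" "dot \<beta> q = 1" using det by simp_all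
  qed
  define f where "f P = dot \<alpha> (rep_pspace P) / dot \<beta> (rep_pspace P)" for P :: "('k, 2) pspace"
  let ?U = "{P. mp_eval (linear_form \<beta>) (rep_pspace P) \<noteq> 0}"
  have open_U: "zariski_open ?U" by (rule zariski_open_nonzero[OF homogeneous_linear_form])
  have "q \<noteq> 0" using det by auto
  then obtain c where "c \<noteq> 0" "rep_pspace (abs_pspace q) = c *s q" by (rule rep_abs_pspace)
  then have "abs_pspace q \<in> ?U" by (simp add: dot_smult_right dual)
  then have "?U \<inter> UNIV \<noteq> {}" by blast
  moreover have "regular_on (?U \<inter> UNIV) f"
    unfolding regular_on_def
  proof
    fix P assume "P \<in> ?U \<inter> UNIV"
    then show "\<exists>U d F G. zariski_open U \<and> P \<in> U \<and> homogeneous d F \<and> homogeneous d G \<and>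
        (\<forall>Q\<in>U \<inter> (?U \<inter> UNIV). mp_eval G (rep_pspace Q) \<noteq> 0 \<and>
           f Q = mp_eval F (rep_pspace Q) / mp_eval G (rep_pspace Q))"
      by (intro exI[of _ ?U] exI[of _ 1] exI[of _ "linear_form \<alpha>"] exI[of _ "linear_form \<beta>"] conjI
          open_U homogeneous_linear_form) (auto simp: f_def)
  qed
  ultimately have "germ UNIV f \<in> carrier (function_field UNIV)"
    using open_U by (auto simp: function_field_def)
  then have "germ C (f \<circ> projection R) \<in> projected_field C R"
    unfolding projected_field_def by (metis imageI pullback_projection_germ)
  moreover have "germ C (f \<circ> projection R) = germ C (affine_coord S j l)"
    unfolding germ_eq_iff[OF irreducible]
    using eventually_denominator_nonzero[OF frame(1,5)]
  proof eventually_elim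
    case (elim Q)
    from proj[OF this] show ?case
      by (auto simp: f_def dot_smult_right dot_add_right dual)
  qed
  ultimately show ?thesis by simp
qed

text \<open>At \<open>x *s p + q\<close> a fraction of two forms of equal degree becomes a fraction
  of polynomials in \<open>x\<close>, and the factor of the representative cancels. So the affine
  coordinate generates the projected field over the constants.\<close>

lemma projected_field_rational_in_affine_coord:
  assumes "b \<in> projected_field C R"
  obtains P D where "eventually (\<lambda>Q. poly D (affine_coord S j l Q) \<noteq> 0) (generic C)"
    "b = germ C (\<lambda>Q. poly P (affine_coord S j l Q) / poly D (affine_coord S j l Q))"
proof -
  obtain p q :: "'k ^ 2" where det: "p $ 1 * q $ 2 - p $ 2 * q $ 1 \<noteq> 0"
    and proj: "\<And>Q. (S *v rep_pspace Q) $ l \<noteq> 0 \<Longrightarrow>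
       \<exists>c. c \<noteq> 0 \<and> rep_pspace (projection R Q) = c *s (affine_coord S j l Q *s p + q)"
    using projection_affine_coord[OF frame] by blast
  from assms obtain f U where b: "b = pullback C (projection R) (germ UNIV f)"
    and U: "zariski_open U" "U \<noteq> {}" "regular_on U f"
    by (auto simp: projected_field_def function_field_def)
  then obtain P0 where "P0 \<in> U" by blast
  with U(3) obtain V e F G where V: "zariski_open V" "P0 \<in> V" "homogeneous e F" "homogeneous e G"
    "\<forall>Q\<in>V \<inter> U. mp_eval G (rep_pspace Q) \<noteq> 0 \<and> f Q = mp_eval F (rep_pspace Q) / mp_eval G (rep_pspace Q)"
    unfolding regular_on_def by blast
  have "zariski_open (V \<inter> U)" "V \<inter> U \<noteq> {}" using zariski_open_Int U(1) V(1,2) \<open>P0 \<in> U\<close> by auto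
  note ev = eventually_projection_in_open[OF this]
  define P where "P = mp_to_poly (\<lambda>i. [:q $ i, p $ i:]) F"
  define D where "D = mp_to_poly (\<lambda>i. [:q $ i, p $ i:]) G"
  have "(\<chi> i. poly [:q $ i, p $ i:] x) = x *s p + q" for x by (simp add: vec_eq_iff)
  then have poly: "poly P x = mp_eval F (x *s p + q)" "poly D x = mp_eval G (x *s p + q)" for x
    by (simp_all add: P_def D_def poly_mp_to_poly)
  have *: "eventually (\<lambda>Q. poly D (affine_coord S j l Q) \<noteq> 0 \<and> (f \<circ> projection R) Q =
      poly P (affine_coord S j l Q) / poly D (affine_coord S j l Q)) (generic C)"
    using ev eventually_denominator_nonzero[OF frame(1,5)]
  proof eventually_elim
    case (elim Q)
    from proj[OF elim(2)] obtain c where c: "c \<noteq> 0"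
      "rep_pspace (projection R Q) = c *s (affine_coord S j l Q *s p + q)" by blast
    have "mp_eval G (rep_pspace (projection R Q)) \<noteq> 0"
      "f (projection R Q) = mp_eval F (rep_pspace (projection R Q)) / mp_eval G (rep_pspace (projection R Q))"
      using V(5) elim(1) by auto
    then show ?case
      unfolding c(2) mp_eval_scale[OF V(3)] mp_eval_scale[OF V(4)] using c(1) by (simp add: poly)
  qed
  show ?thesis
  proof (rule that)
    show "eventually (\<lambda>Q. poly D (affine_coord S j l Q) \<noteq> 0) (generic C)"
      using * by eventually_elim simp
    show "b = germ C (\<lambda>Q. poly P (affine_coord S j l Q) / poly D (affine_coord S j l Q))"
      unfolding b pullback_projection_germ germ_eq_iff[OF irreducible] using * by eventually_elim simp
  qed
qed

end

end

text \<open>The set \<open>A\<close> of values at which the two substitutions are inverse to each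
  other contains the generic values of \<open>s\<close>. It is infinite because \<open>s\<close>
  generically avoids any finite set, so the statement about polynomials applies.\<close>

lemma Moebius_of_mutually_rational:
  fixes s s' :: "('k::alg_closed_field, 'n::finite) pspace \<Rightarrow> 'k"
  assumes X: "irreducible_set X"
    and s: "\<And>c. eventually (\<lambda>Q. s Q \<noteq> c) (generic X)"
    and P: "eventually (\<lambda>Q. poly D (s Q) \<noteq> 0 \<and> s' Q = poly P (s Q) / poly D (s Q)) (generic X)"
    and P': "eventually (\<lambda>Q. poly D' (s' Q) \<noteq> 0 \<and> s Q = poly P' (s' Q) / poly D' (s' Q)) (generic X)"
  obtains a b c d where "c \<noteq> 0 \<or> d \<noteq> 0"
    "eventually (\<lambda>Q. s' Q * (c * s Q + d) = a * s Q + b) (generic X)"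
proof -
  define A where "A = {x. poly D x \<noteq> 0 \<and> poly D' (poly P x / poly D x) \<noteq> 0 \<and>
     poly P' (poly P x / poly D x) = x * poly D' (poly P x / poly D x)}"
  have sA: "eventually (\<lambda>Q. s Q \<in> A) (generic X)"
    using P P' by eventually_elim (auto simp: A_def field_simps)
  have "infinite A"
  proof
    assume "finite A"
    then have "eventually (\<lambda>Q. \<forall>c\<in>A. s Q \<noteq> c) (generic X)"
      using s by (subst eventually_ball_finite_distrib) auto
    with sA have "eventually (\<lambda>Q. False) (generic X)" by eventually_elim blast
    then show False using generic_nontrivial[OF X] by (simp add: trivial_limit_def)
  qed
  have inv: "poly D x \<noteq> 0 \<and> poly D' (poly P x / poly D x) \<noteq> 0 \<and>
     poly P' (poly P x / poly D x) = x * poly D' (poly P x / poly D x)" if "x \<in> A" for x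
    using that by (simp add: A_def)
  obtain a b c d where m: "c \<noteq> 0 \<or> d \<noteq> 0"
    "\<And>x. poly P x * (c * x + d) = poly D x * (a * x + b)"
    by (rule rational_inverse_imp_Moebius[OF \<open>infinite A\<close> inv]) (assumption, rule that)
  from P have "eventually (\<lambda>Q. s' Q * (c * s Q + d) = a * s Q + b) (generic X)"
  proof eventually_elim
    case (elim Q)
    then show ?case using m(2)[of "s Q"] by (simp add: field_simps)
  qed
  with m(1) show ?thesis by (rule that)
qed

section \<open>Comparison of two embeddings\<close>

text \<open>The coordinate of the second embedding lies in the common field, which the coordinate of
  the first generates. Exchanging the embeddings gives the converse dependence.\<close>

lemma ex_rational_in_affine_coord:
  fixes \<phi> \<phi>' :: "('k::alg_closed_field, 'n::finite) pspace \<Rightarrow> ('k, 3) pspace"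
    and S S' :: "'k ^ 3 ^ 3" and i j l :: 3
  assumes X: "irreducible_set X" and "morphism_on X \<phi>" "morphism_on X \<phi>'"
    and "nonlinear_curve (\<phi> ` X) d" "nonlinear_curve (\<phi>' ` X) d'"
    and fields: "pullback X \<phi> ` projected_field (\<phi> ` X) R = pullback X \<phi>' ` projected_field (\<phi>' ` X) R'"
    and S: "invertible S" "S *v rep_pspace R = axis i 1"
    and S': "invertible S'" "S' *v rep_pspace R' = axis i 1"
    and ijl: "i \<noteq> j" "i \<noteq> l" "j \<noteq> l"
  obtains P D where "eventually (\<lambda>Q. poly D (affine_coord S j l (\<phi> Q)) \<noteq> 0 \<and>
    affine_coord S' j l (\<phi>' Q) =
      poly P (affine_coord S j l (\<phi> Q)) / poly D (affine_coord S j l (\<phi> Q))) (generic X)"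
proof -
  interpret C: nonlinear_curve "\<phi> ` X" d by fact
  interpret C': nonlinear_curve "\<phi>' ` X" d' by fact
  note lim = filterlim_generic_image[OF X assms(2)] and lim' = filterlim_generic_image[OF X assms(3)]
  have "pullback X \<phi>' (germ (\<phi>' ` X) (affine_coord S' j l)) \<in> pullback X \<phi> ` projected_field (\<phi> ` X) R"
    unfolding fields by (rule imageI) (rule C'.affine_coord_mem_projected_field[OF S' ijl])
  then obtain b where b: "b \<in> projected_field (\<phi> ` X) R"
    "pullback X \<phi>' (germ (\<phi>' ` X) (affine_coord S' j l)) = pullback X \<phi> b" by blast
  obtain P D where PD: "eventually (\<lambda>Q. poly D (affine_coord S j l Q) \<noteq> 0) (generic (\<phi> ` X))"
    "b = germ (\<phi> ` X) (\<lambda>Q. poly P (affine_coord S j l Q) / poly D (affine_coord S j l Q))"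
    by (rule C.projected_field_rational_in_affine_coord[OF S ijl b(1)])
  have "eventually (\<lambda>Q. affine_coord S' j l (\<phi>' Q) =
      poly P (affine_coord S j l (\<phi> Q)) / poly D (affine_coord S j l (\<phi> Q))) (generic X)"
    using b(2) unfolding PD(2) pullback_germ[OF X C.irreducible lim] pullback_germ[OF X C'.irreducible lim']
      germ_eq_iff[OF X] by simp
  with eventually_compose_filterlim[OF PD(1) lim] show ?thesis
    by (intro that eventually_conj)
qed

text \<open>The point \<open>Q0\<close> forces the Moebius transformation between the two generators of the common
  field to fix infinity.\<close>

lemma affine_relation:
  fixes \<phi> \<phi>' :: "('k::alg_closed_field, 'n::finite) pspace \<Rightarrow> ('k, 3) pspace"
    and S S' :: "'k ^ 3 ^ 3" and i j l :: 3
  assumes X: "irreducible_set X" and mor: "morphism_on X \<phi>" "morphism_on X \<phi>'"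
    and curves: "nonlinear_curve (\<phi> ` X) d" "nonlinear_curve (\<phi>' ` X) d'"
    and fields: "pullback X \<phi> ` projected_field (\<phi> ` X) R = pullback X \<phi>' ` projected_field (\<phi>' ` X) R'"
    and S: "invertible S" "S *v rep_pspace R = axis i 1"
    and S': "invertible S'" "S' *v rep_pspace R' = axis i 1"
    and ijl: "i \<noteq> j" "i \<noteq> l" "j \<noteq> l"
    and Q0: "Q0 \<in> X" "(S *v rep_pspace (\<phi> Q0)) $ l = 0" "(S *v rep_pspace (\<phi> Q0)) $ j \<noteq> 0"
      "(S' *v rep_pspace (\<phi>' Q0)) $ l = 0" "(S' *v rep_pspace (\<phi>' Q0)) $ j \<noteq> 0"
  obtains a b where "a \<noteq> 0" "\<And>Q. Q \<in> X \<Longrightarrow>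
     (S *v rep_pspace (\<phi> Q)) $ l * (S' *v rep_pspace (\<phi>' Q)) $ j =
     (a * (S *v rep_pspace (\<phi> Q)) $ j + b * (S *v rep_pspace (\<phi> Q)) $ l) * (S' *v rep_pspace (\<phi>' Q)) $ l"
proof -
  interpret C: nonlinear_curve "\<phi> ` X" d by fact
  interpret C': nonlinear_curve "\<phi>' ` X" d' by fact
  note lim = filterlim_generic_image[OF X mor(1)] and lim' = filterlim_generic_image[OF X mor(2)]
  define \<Phi> where "\<Phi> Q = S *v rep_pspace (\<phi> Q)" for Q
  define \<Phi>' where "\<Phi>' Q = S' *v rep_pspace (\<phi>' Q)" for Q
  obtain P D where PD: "eventually (\<lambda>Q. poly D (affine_coord S j l (\<phi> Q)) \<noteq> 0 \<and>
    affine_coord S' j l (\<phi>' Q) =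
      poly P (affine_coord S j l (\<phi> Q)) / poly D (affine_coord S j l (\<phi> Q))) (generic X)"
    by (rule ex_rational_in_affine_coord[OF X mor curves fields S S' ijl])
  obtain P' D' where PD': "eventually (\<lambda>Q. poly D' (affine_coord S' j l (\<phi>' Q)) \<noteq> 0 \<and>
    affine_coord S j l (\<phi> Q) =
      poly P' (affine_coord S' j l (\<phi>' Q)) / poly D' (affine_coord S' j l (\<phi>' Q))) (generic X)"
    by (rule ex_rational_in_affine_coord[OF X mor(2,1) curves(2,1) fields[symmetric] S' S ijl])
  have neq: "eventually (\<lambda>Q. affine_coord S j l (\<phi> Q) \<noteq> c) (generic X)" for c
    by (rule eventually_compose_filterlim[OF C.eventually_affine_coord_neq[OF S(1) ijl(3)] lim])
  obtain a b c d where cd: "c \<noteq> 0 \<or> d \<noteq> 0" and ev: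
    "eventually (\<lambda>Q. affine_coord S' j l (\<phi>' Q) * (c * affine_coord S j l (\<phi> Q) + d) =
       a * affine_coord S j l (\<phi> Q) + b) (generic X)"
    by (rule Moebius_of_mutually_rational[OF X neq PD PD'])
  have l: "eventually (\<lambda>Q. \<Phi> Q $ l \<noteq> 0) (generic X)" unfolding \<Phi>_def
    by (rule eventually_compose_filterlim[OF C.eventually_denominator_nonzero[OF S(1) ijl(3)] lim])
  have l': "eventually (\<lambda>Q. \<Phi>' Q $ l \<noteq> 0) (generic X)" unfolding \<Phi>'_def
    by (rule eventually_compose_filterlim[OF C'.eventually_denominator_nonzero[OF S'(1) ijl(3)] lim'])
  have dots: "dot (x *s S $ j + y *s S $ l) (rep_pspace (\<phi> Q)) = x * \<Phi> Q $ j + y * \<Phi> Q $ l"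
    "dot (S' $ m) (rep_pspace (\<phi>' Q)) = \<Phi>' Q $ m" for x y m Q
    by (simp_all add: \<Phi>_def \<Phi>'_def dot_add_left dot_smult_left matrix_vector_mult_nth_dot)
  have rel: "(c * \<Phi> Q $ j + d * \<Phi> Q $ l) * \<Phi>' Q $ j = (a * \<Phi> Q $ j + b * \<Phi> Q $ l) * \<Phi>' Q $ l"
    if "Q \<in> X" for Q
  proof (rule generic_identity[OF X _ _ that, where h = "\<lambda>Q. (c * \<Phi> Q $ j + d * \<Phi> Q $ l) * \<Phi>' Q $ j"])
    show "rel_open X {Q \<in> X. (c * \<Phi> Q $ j + d * \<Phi> Q $ l) * \<Phi>' Q $ j \<noteq>
        (a * \<Phi> Q $ j + b * \<Phi> Q $ l) * \<Phi>' Q $ l}"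
      using rel_open_bilinear[OF mor, of "c *s S $ j + d *s S $ l" "S' $ j" "a *s S $ j + b *s S $ l" "S' $ l"]
      unfolding dots .
    show "eventually (\<lambda>Q. (c * \<Phi> Q $ j + d * \<Phi> Q $ l) * \<Phi>' Q $ j =
        (a * \<Phi> Q $ j + b * \<Phi> Q $ l) * \<Phi>' Q $ l) (generic X)"
      using ev l l'
    proof eventually_elim
      case (elim Q)
      have "(c * \<Phi> Q $ j + d * \<Phi> Q $ l) * \<Phi>' Q $ j =
          (\<Phi>' Q $ j / \<Phi>' Q $ l) * (c * (\<Phi> Q $ j / \<Phi> Q $ l) + d) * (\<Phi> Q $ l * \<Phi>' Q $ l)"
        using elim(2,3) by (simp add: field_simps)
      also have "\<dots> = (a * (\<Phi> Q $ j / \<Phi> Q $ l) + b) * (\<Phi> Q $ l * \<Phi>' Q $ l)"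
        using elim(1) by (simp add: affine_coord_def \<Phi>_def \<Phi>'_def)
      also have "\<dots> = (a * \<Phi> Q $ j + b * \<Phi> Q $ l) * \<Phi>' Q $ l"
        using elim(2,3) by (simp add: field_simps)
      finally show ?case .
    qed
  qed
  \<comment> \<open>At \<open>Q0\<close> both \<open>l\<close>-th coordinates vanish while both
    \<open>j\<close>-th ones do not, so the relation reduces to a nonzero multiple of
    \<open>c\<close> being 0.\<close>
  have c: "c = 0" using rel[OF Q0(1)] Q0 by (simp add: \<Phi>_def \<Phi>'_def)
  with cd have d: "d \<noteq> 0" by simp
  \<comment> \<open>Otherwise the coordinate of the second embedding would generically be the
    constant \<open>b / d\<close>.\<close>
  have "a \<noteq> 0"
  proof
    assume "a = 0"
    have "eventually (\<lambda>Q. affine_coord S' j l (\<phi>' Q) \<noteq> b / d) (generic X)"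
      by (rule eventually_compose_filterlim[OF C'.eventually_affine_coord_neq[OF S'(1) ijl(3)] lim'])
    with ev have "eventually (\<lambda>Q. False) (generic X)"
      by eventually_elim (use c d \<open>a = 0\<close> in \<open>simp add: field_simps\<close>)
    then show False using generic_nontrivial[OF X] by (simp add: trivial_limit_def)
  qed
  moreover have "\<Phi> Q $ l * \<Phi>' Q $ j = (a / d * \<Phi> Q $ j + b / d * \<Phi> Q $ l) * \<Phi>' Q $ l" if "Q \<in> X" for Q
    using rel[OF that] c d by (simp add: field_simps)
  ultimately show ?thesis using d by (intro that[of "a / d" "b / d"]) (simp_all add: \<Phi>_def \<Phi>'_def)
qed

text \<open>On the line through \<open>R1\<close> and \<open>R2\<close> a representative is a
  combination of theirs, and a vanishing coefficient would make \<open>P\<close> equal to the other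
  point. This supplies the poles for the affine relations.\<close>

lemma coords_on_line:
  assumes S: "S *v rep_pspace R1 = axis 1 1" "S *v rep_pspace R2 = axis 2 1"
    and P: "P \<in> line_through R1 R2"
  shows "(S *v rep_pspace P) $ (3::3) = 0"
    and "P \<noteq> R1 \<Longrightarrow> (S *v rep_pspace P) $ 2 \<noteq> 0"
    and "P \<noteq> R2 \<Longrightarrow> (S *v rep_pspace P) $ 1 \<noteq> 0"
proof -
  from P obtain x where "rep_pspace P - x *s rep_pspace R1 \<in> vec.span {rep_pspace R2}"
    unfolding line_through_def by (auto simp: vec.span_insert)
  then obtain y where "rep_pspace P - x *s rep_pspace R1 = y *s rep_pspace R2"
    by (auto simp: vec.span_singleton)
  then have P: "rep_pspace P = x *s rep_pspace R1 + y *s rep_pspace R2" by (simp add: algebra_simps)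
  then have SP: "S *v rep_pspace P = x *s axis 1 1 + y *s axis 2 1"
    by (simp only: matrix_vector_right_distrib vector_scalar_commute S)
  show "(S *v rep_pspace P) $ 3 = 0" by (simp add: SP axis_def)
  have "P = R1" if "y = 0"
    using P that by (simp flip: rep_pspace_in_span_iff add: vec.span_base vec.span_scale)
  then show "(S *v rep_pspace P) $ 2 \<noteq> 0" if "P \<noteq> R1" using that by (auto simp: SP axis_def)
  have "P = R2" if "x = 0"
    using P that by (simp flip: rep_pspace_in_span_iff add: vec.span_base vec.span_scale)
  then show "(S *v rep_pspace P) $ 1 \<noteq> 0" if "P \<noteq> R2" using that by (auto simp: SP axis_def)
qed

lemma ex_linear_transformation:
  fixes \<phi> \<phi>' :: "('k::alg_closed_field, 'n::finite) pspace \<Rightarrow> ('k, 3) pspace"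
  assumes X: "irreducible_set X" and mor: "morphism_on X \<phi>" "morphism_on X \<phi>'"
    and curves: "nonlinear_curve (\<phi> ` X) d" "nonlinear_curve (\<phi>' ` X) d'"
    and ne: "R1 \<noteq> R2" "R1' \<noteq> R2'"
    and fields1: "pullback X \<phi> ` projected_field (\<phi> ` X) R1 = pullback X \<phi>' ` projected_field (\<phi>' ` X) R1'"
    and fields2: "pullback X \<phi> ` projected_field (\<phi> ` X) R2 = pullback X \<phi>' ` projected_field (\<phi>' ` X) R2'"
    and Q1: "Q1 \<in> X" "\<phi> Q1 \<in> line_through R1 R2" "\<phi> Q1 \<noteq> R1"
      "\<phi>' Q1 \<in> line_through R1' R2'" "\<phi>' Q1 \<noteq> R1'"
    and Q2: "Q2 \<in> X" "\<phi> Q2 \<in> line_through R1 R2" "\<phi> Q2 \<noteq> R2"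
      "\<phi>' Q2 \<in> line_through R1' R2'" "\<phi>' Q2 \<noteq> R2'"
  shows "\<exists>T. plane_linear_transformation T \<and> (\<forall>P\<in>X. \<phi>' P = T (\<phi> P))"
proof -
  interpret C: nonlinear_curve "\<phi> ` X" d by fact
  obtain S :: "'k ^ 3 ^ 3" where S: "invertible S" "S *v rep_pspace R1 = axis 1 1" "S *v rep_pspace R2 = axis 2 1"
    using ex_frame[of "rep_pspace R1" "rep_pspace R2"] ne(1) rep_pspace_in_span_iff rep_pspace_nonzero by metis
  obtain S' :: "'k ^ 3 ^ 3" where S': "invertible S'" "S' *v rep_pspace R1' = axis 1 1" "S' *v rep_pspace R2' = axis 2 1"
    using ex_frame[of "rep_pspace R1'" "rep_pspace R2'"] ne(2) rep_pspace_in_span_iff rep_pspace_nonzero by metis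
  note line = coords_on_line[OF S(2,3)] and line' = coords_on_line[OF S'(2,3)]
  define \<Phi> where "\<Phi> Q = S *v rep_pspace (\<phi> Q)" for Q
  define \<Phi>' where "\<Phi>' Q = S' *v rep_pspace (\<phi>' Q)" for Q
  have ijl: "1 \<noteq> (2::3)" "1 \<noteq> (3::3)" "2 \<noteq> (3::3)" by simp_all
  obtain a b where ab: "a \<noteq> 0" "\<And>Q. Q \<in> X \<Longrightarrow>
      \<Phi> Q $ 3 * \<Phi>' Q $ 2 = (a * \<Phi> Q $ 2 + b * \<Phi> Q $ 3) * \<Phi>' Q $ 3"
    by (rule affine_relation[OF X mor curves fields1 S(1,2) S'(1,2) ijl Q1(1)
          line(1)[OF Q1(2)] line(2)[OF Q1(2,3)] line'(1)[OF Q1(4)] line'(2)[OF Q1(4,5)], folded \<Phi>_def \<Phi>'_def]) (rule that)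
  obtain a' b' where ab': "a' \<noteq> 0" "\<And>Q. Q \<in> X \<Longrightarrow>
      \<Phi> Q $ 3 * \<Phi>' Q $ 1 = (a' * \<Phi> Q $ 1 + b' * \<Phi> Q $ 3) * \<Phi>' Q $ 3"
    by (rule affine_relation[OF X mor curves fields2 S(1,3) S'(1,3) ijl(1)[symmetric] ijl(3,2) Q2(1)
          line(1)[OF Q2(2)] line(3)[OF Q2(2,3)] line'(1)[OF Q2(4)] line'(3)[OF Q2(4,5)], folded \<Phi>_def \<Phi>'_def]) (rule that)
  \<comment> \<open>In the two frames the affine relations say that x/z becomes
    \<open>a' * (x/z) + b'\<close> and y/z becomes \<open>a * (y/z) + b\<close>; \<open>N\<close> is
    the matrix of this affine map.\<close>
  define N :: "'k ^ 3 ^ 3" where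
    "N = vector [vector [a', 0, b'], vector [0, a, b], vector [0, 0, 1]]"
  have N: "N *v u = vector [a' * u $ 1 + b' * u $ 3, a * u $ 2 + b * u $ 3, u $ 3]" for u
    by (simp add: N_def matrix_vector_mult_def vec_eq_iff forall_3 sum_3)
  have "u = 0" if "N *v u = 0" for u
    using that ab(1) ab'(1) by (auto simp: N vec_eq_iff forall_3)
  then obtain N' where "N' ** N = mat 1" using matrix_left_invertible_ker[of N] by blast
  then have inv_N: "invertible N" using matrix_left_right_inverse[of N' N] unfolding invertible_def by blast
  from S'(1) obtain T' where T': "T' ** S' = mat 1" "S' ** T' = mat 1" by (auto simp: invertible_def)
  define M where "M = T' ** (N ** S)"
  have "invertible T'" using T' by (auto simp: invertible_def)
  then have inv_M: "invertible M" unfolding M_def by (intro invertible_mult inv_N S(1))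
  have M: "M *v v = T' *v (N *v (S *v v))" for v by (simp add: M_def matrix_vector_mul_assoc)
  have scaled: "\<Phi> Q $ 3 *s rep_pspace (\<phi>' Q) = \<Phi>' Q $ 3 *s (M *v rep_pspace (\<phi> Q))" if "Q \<in> X" for Q
  proof -
    have "\<Phi> Q $ 3 *s \<Phi>' Q = \<Phi>' Q $ 3 *s (N *v \<Phi> Q)"
      using ab(2)[OF that] ab'(2)[OF that] by (simp add: N vec_eq_iff forall_3 mult.commute)
    then have "T' *v (\<Phi> Q $ 3 *s \<Phi>' Q) = T' *v (\<Phi>' Q $ 3 *s (N *v \<Phi> Q))" by simp
    then have "\<Phi> Q $ 3 *s (T' *v \<Phi>' Q) = \<Phi>' Q $ 3 *s (M *v rep_pspace (\<phi> Q))"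
      by (simp only: vector_scalar_commute M \<Phi>_def)
    moreover have "T' *v \<Phi>' Q = rep_pspace (\<phi>' Q)"
      unfolding \<Phi>'_def by (simp add: matrix_vector_mul_assoc T')
    ultimately show ?thesis by simp
  qed
  \<comment> \<open>The scaled equation may lose its content where \<open>\<Phi> Q $ 3\<close>
    vanishes, that is on the line through the Galois points. The 2x2 minors of the two vectors are
    free of these factors and vanish generically, hence on all of \<open>X\<close>.\<close>
  have minors: "(M *v rep_pspace (\<phi> Q)) $ m * rep_pspace (\<phi>' Q) $ n =
      (M *v rep_pspace (\<phi> Q)) $ n * rep_pspace (\<phi>' Q) $ m" if "Q \<in> X" for Q m n
  proof (rule generic_identity[OF X _ _ that,
        where h = "\<lambda>Q. (M *v rep_pspace (\<phi> Q)) $ m * rep_pspace (\<phi>' Q) $ n"])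
    show "rel_open X {Q \<in> X. (M *v rep_pspace (\<phi> Q)) $ m * rep_pspace (\<phi>' Q) $ n \<noteq>
        (M *v rep_pspace (\<phi> Q)) $ n * rep_pspace (\<phi>' Q) $ m}"
      using rel_open_bilinear[OF mor, of "M $ m" "axis n 1" "M $ n" "axis m 1"]
      unfolding dot_axis_left matrix_vector_mult_nth_dot .
    have "eventually (\<lambda>Q. \<Phi> Q $ 3 \<noteq> 0) (generic X)"
      unfolding \<Phi>_def
      by (rule eventually_compose_filterlim[OF C.eventually_denominator_nonzero[OF S(1) ijl(3)]
            filterlim_generic_image[OF X mor(1)]])
    then show "eventually (\<lambda>Q. (M *v rep_pspace (\<phi> Q)) $ m * rep_pspace (\<phi>' Q) $ n =
        (M *v rep_pspace (\<phi> Q)) $ n * rep_pspace (\<phi>' Q) $ m) (generic X)"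
      using eventually_generic_in[OF X]
    proof eventually_elim
      case (elim Q)
      let ?m = "M *v rep_pspace (\<phi> Q)" and ?r = "rep_pspace (\<phi>' Q)"
      have eq: "\<Phi> Q $ 3 * ?r $ k = \<Phi>' Q $ 3 * ?m $ k" for k
        using scaled[OF elim(2)] by (metis vector_smult_component)
      have "\<Phi> Q $ 3 * (?m $ m * ?r $ n) = ?m $ m * (\<Phi> Q $ 3 * ?r $ n)" by (rule mult.left_commute)
      also have "\<dots> = ?m $ n * (\<Phi> Q $ 3 * ?r $ m)" unfolding eq by (simp only: ac_simps)
      also have "\<dots> = \<Phi> Q $ 3 * (?m $ n * ?r $ m)" by (rule mult.left_commute)
      finally have "\<Phi> Q $ 3 * (?m $ m * ?r $ n) = \<Phi> Q $ 3 * (?m $ n * ?r $ m)" .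
      with elim(1) show ?case by simp
    qed
  qed
  have "\<phi>' Q = abs_pspace (M *v rep_pspace (\<phi> Q))" if Q: "Q \<in> X" for Q
  proof -
    let ?m = "M *v rep_pspace (\<phi> Q)"
    from inv_M obtain M' where "M' ** M = mat 1" by (auto simp: invertible_def)
    then have "M' *v ?m = rep_pspace (\<phi> Q)" by (simp add: matrix_vector_mul_assoc)
    then have m0: "?m \<noteq> 0" by (metis matrix_vector_mult_0_right rep_pspace_nonzero)
    then obtain k where k: "?m $ k \<noteq> 0" by (auto simp: vec_eq_iff)
    \<comment> \<open>Vanishing of all minors together with one nonzero coordinate \<open>k\<close>
      makes the two vectors proportional with this factor.\<close>
    define c where "c = rep_pspace (\<phi>' Q) $ k / ?m $ k"
    have eq: "rep_pspace (\<phi>' Q) = c *s ?m"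
      using minors[OF Q, of k] k by (simp add: c_def vec_eq_iff field_simps)
    then have "c \<noteq> 0" using rep_pspace_nonzero[of "\<phi>' Q"] by (auto simp del: rep_pspace_nonzero)
    then have "abs_pspace (rep_pspace (\<phi>' Q)) = abs_pspace ?m" unfolding eq using m0 by simp
    then show ?thesis by simp
  qed
  then show ?thesis
    unfolding plane_linear_transformation_def
    by (intro exI[of _ "\<lambda>Q. abs_pspace (M *v rep_pspace Q)"]) (use inv_M in auto)
qed

lemma mem_line_through: "R1 \<in> line_through R1 R2" "R2 \<in> line_through R1 R2"
  by (auto simp: line_through_def intro: vec.span_base)

lemma nonlinear_curve_image:
  fixes X :: "('k::alg_closed_field, 'n::finite) pspace set"
  assumes "irreducible_set X" "birational_embedding X \<phi>" "has_plane_degree (\<phi> ` X) d" "d \<ge> 2"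
  shows "nonlinear_curve (\<phi> ` X) d"
  using assms irreducible_image[of X \<phi>] by unfold_locales (auto simp: birational_embedding_def)

theorem proposition1:
  fixes X :: "('k::alg_closed_field, 'n::finite) pspace set"
    and G1 G2 :: "(('k, 'n) pspace \<Rightarrow> ('k, 'n) pspace) set"
  assumes "smooth_projective_curve X"
    and "subgroup G1 (aut_group X)" and "finite G1" and "card G1 \<ge> 3"
    and "subgroup G2 (aut_group X)" and "finite G2" and "card G2 \<ge> 3"
  shows
    "(\<forall>P1\<in>X. \<forall>P2\<in>X. P1 \<noteq> P2 \<longrightarrow>
        (\<forall>\<phi> \<phi>'. inner_embedding X G1 G2 P1 P2 \<phi> \<and> inner_embedding X G1 G2 P1 P2 \<phi>' \<longrightarrow>
           (\<exists>T. plane_linear_transformation T \<and> (\<forall>P\<in>X. \<phi>' P = T (\<phi> P))))) \<and>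
     (\<forall>Q\<in>X.
        (\<forall>\<phi> \<phi>'. outer_embedding X G1 G2 Q \<phi> \<and> outer_embedding X G1 G2 Q \<phi>' \<longrightarrow>
           (\<exists>T. plane_linear_transformation T \<and> (\<forall>P\<in>X. \<phi>' P = T (\<phi> P)))))"
proof -
  have X: "irreducible_set X" using assms(1) by (simp add: smooth_projective_curve_def)
  have G: "G1 \<subseteq> carrier (aut_group X)" "G2 \<subseteq> carrier (aut_group X)"
    using assms(2,5) by (simp_all add: subgroup.subset)
  \<comment> \<open>Both sides are the subfield of the function field of \<open>X\<close> fixed by
    the same group \<open>G\<close>.\<close>
  have field: "pullback X \<phi> ` projected_field (\<phi> ` X) R = pullback X \<phi>' ` projected_field (\<phi>' ` X) R'"
    if "birational_embedding X \<phi>" "birational_embedding X \<phi>'" "galois_point (\<phi> ` X) R" "galois_point (\<phi>' ` X) R'"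
      "is_galois_group_at X \<phi> R G" "is_galois_group_at X \<phi>' R' G" "G \<subseteq> carrier (aut_group X)"
    for \<phi> \<phi>' R R' G
    using pullback_projected_field[OF X that(1,3,5,7)] pullback_projected_field[OF X that(2,4,6,7)] by simp
  have mor: "morphism_on X \<phi>" if "birational_embedding X \<phi>" for \<phi> :: "('k, 'n) pspace \<Rightarrow> ('k, 3) pspace"
    using that by (simp add: birational_embedding_def)
  show ?thesis
  proof (intro conjI ballI impI allI)
    fix P1 P2 \<phi> \<phi>'
    assume P: "P1 \<in> X" "P2 \<in> X"
      and "inner_embedding X G1 G2 P1 P2 \<phi> \<and> inner_embedding X G1 G2 P1 P2 \<phi>'"
    then have \<phi>: "birational_embedding X \<phi>" "has_plane_degree (\<phi> ` X) (card G1 + 1)" "\<phi> P1 \<noteq> \<phi> P2"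
        "galois_point (\<phi> ` X) (\<phi> P1)" "galois_point (\<phi> ` X) (\<phi> P2)"
        "is_galois_group_at X \<phi> (\<phi> P1) G1" "is_galois_group_at X \<phi> (\<phi> P2) G2"
      and \<phi>': "birational_embedding X \<phi>'" "has_plane_degree (\<phi>' ` X) (card G1 + 1)" "\<phi>' P1 \<noteq> \<phi>' P2"
        "galois_point (\<phi>' ` X) (\<phi>' P1)" "galois_point (\<phi>' ` X) (\<phi>' P2)"
        "is_galois_group_at X \<phi>' (\<phi>' P1) G1" "is_galois_group_at X \<phi>' (\<phi>' P2) G2"
      by (simp_all add: inner_embedding_def inner_galois_point_def)
    have "card G1 + 1 \<ge> 2" using assms(4) by simp
    then have curves: "nonlinear_curve (\<phi> ` X) (card G1 + 1)" "nonlinear_curve (\<phi>' ` X) (card G1 + 1)"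
      using \<phi>(1,2) \<phi>'(1,2) nonlinear_curve_image[OF X] by blast+
    show "\<exists>T. plane_linear_transformation T \<and> (\<forall>P\<in>X. \<phi>' P = T (\<phi> P))"
      by (rule ex_linear_transformation[OF X mor[OF \<phi>(1)] mor[OF \<phi>'(1)] curves \<phi>(3) \<phi>'(3)
            field[OF \<phi>(1) \<phi>'(1) \<phi>(4) \<phi>'(4) \<phi>(6) \<phi>'(6) G(1)]
            field[OF \<phi>(1) \<phi>'(1) \<phi>(5) \<phi>'(5) \<phi>(7) \<phi>'(7) G(2)]
            P(2) mem_line_through(2) \<phi>(3)[symmetric] mem_line_through(2) \<phi>'(3)[symmetric]
            P(1) mem_line_through(1) \<phi>(3) mem_line_through(1) \<phi>'(3)])
  next
    fix Q \<phi> \<phi>'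
    assume Q: "Q \<in> X" and "outer_embedding X G1 G2 Q \<phi> \<and> outer_embedding X G1 G2 Q \<phi>'"
    then obtain R1 R2 R1' R2' where \<phi>: "birational_embedding X \<phi>" "has_plane_degree (\<phi> ` X) (card G1)" "R1 \<noteq> R2"
        "galois_point (\<phi> ` X) R1" "galois_point (\<phi> ` X) R2" "R1 \<notin> \<phi> ` X" "R2 \<notin> \<phi> ` X"
        "is_galois_group_at X \<phi> R1 G1" "is_galois_group_at X \<phi> R2 G2" "\<phi> Q \<in> line_through R1 R2"
      and \<phi>': "birational_embedding X \<phi>'" "has_plane_degree (\<phi>' ` X) (card G1)" "R1' \<noteq> R2'"
        "galois_point (\<phi>' ` X) R1'" "galois_point (\<phi>' ` X) R2'" "R1' \<notin> \<phi>' ` X" "R2' \<notin> \<phi>' ` X"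
        "is_galois_group_at X \<phi>' R1' G1" "is_galois_group_at X \<phi>' R2' G2" "\<phi>' Q \<in> line_through R1' R2'"
      unfolding outer_embedding_def outer_galois_point_def by blast
    have ne: "\<phi> Q \<noteq> R1" "\<phi> Q \<noteq> R2" "\<phi>' Q \<noteq> R1'" "\<phi>' Q \<noteq> R2'"
      using Q \<phi>(6,7) \<phi>'(6,7) by auto
    have "card G1 \<ge> 2" using assms(4) by simp
    then have curves: "nonlinear_curve (\<phi> ` X) (card G1)" "nonlinear_curve (\<phi>' ` X) (card G1)"
      using \<phi>(1,2) \<phi>'(1,2) nonlinear_curve_image[OF X] by blast+
    show "\<exists>T. plane_linear_transformation T \<and> (\<forall>P\<in>X. \<phi>' P = T (\<phi> P))"
      by (rule ex_linear_transformation[OF X mor[OF \<phi>(1)] mor[OF \<phi>'(1)] curves \<phi>(3) \<phi>'(3)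
            field[OF \<phi>(1) \<phi>'(1) \<phi>(4) \<phi>'(4) \<phi>(8) \<phi>'(8) G(1)]
            field[OF \<phi>(1) \<phi>'(1) \<phi>(5) \<phi>'(5) \<phi>(9) \<phi>'(9) G(2)]
            Q \<phi>(10) ne(1) \<phi>'(10) ne(3) Q \<phi>(10) ne(2) \<phi>'(10) ne(4)])
  qed
qed

end
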